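(* Assume that Assumption (E) (defined in the context) holds true, and let $\nu_{QSD}$ and $\theta_0$ be as in the context. Then there exists a function $\eta:E\to\mathbb{R}_+$ such that $$\eta(x)=\lim_{n\to+\infty}\frac{\mathbb{P}_x(n<\tau_\partial)}{\mathbb{P}_{\nu_{QSD}}(n<\tau_\partial)}=\lim_{n\to+\infty}\theta_0^{-n}\,\mathbb{P}_x(n<\tau_\partial),\qquad\forall x\in E,$$ where the convergence is geometric in $L^\infty(\varphi_1)$. In addition, $\inf_{y\in K}\eta(y)>0$, $\nu_{QSD}(\eta)=1$, $\eta\in L^\infty\left(\varphi_1^{\log(1/\theta_0)/\log(1/\theta_1)}\right)$, $$P_1\eta=\theta_0\eta\qquad\text{and}\qquad\theta_0\ge\theta_2>\theta_1.$$
   Context: Setting. $E$ is a measurable space, $\partial\notin E$, $I$ is $\mathbb{R}_+$ or $\frac1k\mathbb{Z}_+$ for some $k\in\mathbb{N}=\{1,2,\ldots\}$, and $(X_t)_{t\in I}$ is a time-homogeneous Markov process in $E\cup\{\partial\}$, with law $\mathbb{P}_x$ when started from $x$, and $\mathbb{P}_\mu=\int\mathbb{P}_x\,\mu(\mathrm dx)$. The point $\partial$ is absorbing: $X_t=\partial$ for all $t\ge\tau_\partial:=\inf\{t\in I:X_t=\partial\}$ almost surely. For $n\in\mathbb{Z}_+$, $P_nf(x)=\mathbb{E}_x(f(X_n)\mathbf{1}_{n<\tau_\partial})$. Also $\mu(f)=\int f\,\mathrm d\mu$. Assumption (E). There exist a positive integer $n_1$, positive real constants $\theta_1,\theta_2,c_1,c_2,c_3$,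 two measurable functions $\varphi_1,\varphi_2:E\to\mathbb{R}_+$ and a probability measure $\nu$ on a measurable subset $K\subset E$ such that: - (E1) for all $x\in K$, $\mathbb{P}_x(X_{n_1}\in\cdot)\ge c_1\nu(\cdot\cap K)$. - (E2) $\theta_1<\theta_2$, $\inf_E\varphi_1\ge1$, $\sup_K\varphi_1<\infty$, $\inf_K\varphi_2>0$, $\sup_E\varphi_2\le1$, and for all $x\in E$, $P_1\varphi_1(x)\le\theta_1\varphi_1(x)+c_2\mathbf{1}_K(x)$ and $P_1\varphi_2(x)\ge\theta_2\varphi_2(x)$. - (E3) $\displaystyle\sup_{n\in\mathbb{Z}_+}\frac{\sup_{y\in K}\mathbb{P}_y(n<\tau_\partial)}{\inf_{y\in K}\mathbb{P}_y(n<\tau_\partial)}\le c_3$. - (E4) for all $x\in K$ there exists $n_4(x)$ such that $\mathbb{P}_x(X_n\in K)>0$ for all $n\ge n_4(x)$. Under Assumption (E), there is a unique probability measure $\nu_{QSD}$ on $E$ which is quasi-stationary, i.e. $\mathbb{P}_{\nu_{QSD}}(X_n\in\cdot\mid n<\tau_\partial)=\nu_{QSD}$ for all $n\in\mathbb{Z}_+$, and satisfies $\nu_{QSD}(\varphi_1)<\infty$ and $\nu_{QSD}(\varphi_2)>0$. The number $\theta_0\in(0,1]$ is its decay parameter: $\mathbb{P}_{\nu_{QSD}}(n<\tau_\partial)=\theta_0^n$ for all $n\in\mathbb{N}$. For a positive function $\psi$ on $E$, $L^\infty(\psi)$ is the Banach space of measurable $f:E\to\mathbb{R}$ with $\|f\|_{L^\infty(\psi)}:=\sup_{x\in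 E}|f(x)|/\psi(x)<\infty$. Geometric convergence of $\eta_n$ to $\eta$ in $L^\infty(\varphi_1)$ means that there exist $C>0$ and $\alpha\in(0,1)$ with $\|\eta_n-\eta\|_{L^\infty(\varphi_1)}\le C\alpha^n$ for all $n\geq 0$. *)

theory Defs
  imports "HOL-Probability.Probability"
begin

section \<open>Absorbed Markov processes\<close>

text \<open>
  The cemetery is a point of the type \<open>'a\<close> outside the space of \<open>E\<close>.  The path map \<open>proc M t\<close> is
  only relevant for \<open>t \<in> time_set M\<close>, and \<open>law M x\<close> only for \<open>x\<close> in \<open>E\<close> or equal to the cemetery.
\<close>

record ('a, 'w) absorbed_process =
  live :: "'a measure"              \<comment> \<open>the measurable space \<open>E\<close>\<close>
  cemetery :: 'a
  time_set :: "real set"            \<comment> \<open>\<open>I\<close>\<close>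
  sample :: "'w measure"            \<comment> \<open>only its measurable structure is used\<close>
  proc :: "real \<Rightarrow> 'w \<Rightarrow> 'a"        \<comment> \<open>\<open>X\<close>\<close>
  law :: "'a \<Rightarrow> 'w measure"          \<comment> \<open>\<open>x \<mapsto> P\<^sub>x\<close>\<close>

definition state_space :: "('a, 'w, 'z) absorbed_process_scheme \<Rightarrow> 'a measure" where
  "state_space M =
     sigma (insert (cemetery M) (space (live M))) (insert {cemetery M} (sets (live M)))"

definition natural_filtration ::
    "('a, 'w, 'z) absorbed_process_scheme \<Rightarrow> real \<Rightarrow> 'w measure" where
  "natural_filtration M s =
     sigma (space (sample M))
       {proc M u -` A \<inter> space (sample M) | u A. u \<in> time_set M \<and> u \<le> s \<and> A \<in> sets (state_space M)}"

text \<open>The hitting time of the cemetery; the infimum of the empty set is \<open>\<infinity>\<close>.\<close>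

definition absorption_time ::
    "('a, 'w, 'z) absorbed_process_scheme \<Rightarrow> 'w \<Rightarrow> ereal" where
  "absorption_time M \<omega> = Inf (ereal ` {t \<in> time_set M. proc M t \<omega> = cemetery M})"

text \<open>
  The transition function is a measurable kernel and the Markov property is with respect to the
  natural filtration, which is implied by the property for any larger filtration.
  Singletons need not be measurable, so \<open>X\<^sub>0 = x\<close> is expressed through the law of \<open>X\<^sub>0\<close>.
\<close>

definition absorbed_markov_process :: "('a, 'w, 'z) absorbed_process_scheme \<Rightarrow> bool" where
  "absorbed_markov_process M \<longleftrightarrow>
     cemetery M \<notin> space (live M) \<and>
     (time_set M = {0..} \<or> (\<exists>k::nat. k \<ge> 1 \<and> time_set M = range (\<lambda>j::nat. real j / real k))) \<and>
     (\<forall>t\<in>time_set M. proc M t \<in> measurable (sample M) (state_space M)) \<and>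
     (\<forall>x\<in>space (state_space M). prob_space (law M x) \<and> sets (law M x) = sets (sample M)) \<and>
     (\<forall>t\<in>time_set M. \<forall>B\<in>sets (state_space M).
        (\<lambda>x. measure (law M x) {\<omega> \<in> space (sample M). proc M t \<omega> \<in> B})
          \<in> borel_measurable (state_space M)) \<and>
     (\<forall>x\<in>space (state_space M).
        distr (law M x) (state_space M) (proc M 0) = return (state_space M) x) \<and>
     (\<forall>x\<in>space (state_space M). \<forall>s\<in>time_set M. \<forall>t\<in>time_set M. \<forall>B\<in>sets (state_space M).
        AE \<omega> in law M x.
          real_cond_exp (law M x) (natural_filtration M s)
              (\<lambda>\<omega>'. indicator B (proc M (s + t) \<omega>')) \<omega>
            = measure (law M (proc M s \<omega>)) {\<omega>' \<in> space (sample M). proc M t \<omega>' \<in> B}) \<and>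
     (\<forall>x\<in>space (state_space M).
        AE \<omega> in law M x. \<forall>t\<in>time_set M. absorption_time M \<omega> \<le> ereal t \<longrightarrow> proc M t \<omega> = cemetery M)"

text \<open>
  When time is continuous the event \<open>n < \<tau>\<close> need not belong to the \<open>\<sigma>\<close>-algebra of the sample space.
  As absorption holds almost surely, it differs from the measurable event \<open>X\<^sub>n \<noteq> \<partial>\<close> by a subset of a
  null set only, so it is measurable for the completion of each \<open>P\<^sub>x\<close>.  All probabilities are
  therefore taken in the completion, which changes nothing on measurable events.
\<close>

definition alive :: "('a, 'w, 'z) absorbed_process_scheme \<Rightarrow> nat \<Rightarrow> 'w set" where
  "alive M n = {\<omega> \<in> space (sample M). ereal (real n) < absorption_time M \<omega>}"

definition in_at ::
    "('a, 'w, 'z) absorbed_process_scheme \<Rightarrow> nat \<Rightarrow> 'a set \<Rightarrow> 'w set" where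
  "in_at M n A = {\<omega> \<in> space (sample M). proc M (real n) \<omega> \<in> A}"

definition pr_from ::
    "('a, 'w, 'z) absorbed_process_scheme \<Rightarrow> 'a \<Rightarrow> 'w set \<Rightarrow> real" where
  "pr_from M x A = measure (completion (law M x)) A"

definition pr_init ::
    "('a, 'w, 'z) absorbed_process_scheme \<Rightarrow> 'a measure \<Rightarrow> 'w set \<Rightarrow> real" where
  "pr_init M \<mu> A = (\<integral>x. pr_from M x A \<partial>\<mu>)"

text \<open>
  The semigroup \<open>P\<^sub>n f(x) = E\<^sub>x(f(X\<^sub>n) 1\<^bsub>n < \<tau>\<^esub>)\<close>, for nonnegative \<open>f\<close> only, with values in \<open>[0,\<infinity>]\<close>,
  so that an upper bound on \<open>P\<^sub>n f\<close> includes its finiteness.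
\<close>

definition semigrp ::
    "('a, 'w, 'z) absorbed_process_scheme \<Rightarrow> nat \<Rightarrow> ('a \<Rightarrow> real) \<Rightarrow> 'a \<Rightarrow> ennreal" where
  "semigrp M n f x =
     (\<integral>\<^sup>+\<omega>. ennreal (f (proc M (real n) \<omega>)) * indicator (alive M n) \<omega> \<partial>completion (law M x))"


section \<open>Assumption (E)\<close>

text \<open>
  The measure \<open>\<nu>\<close> lives on the trace \<open>restrict_space (live M) K\<close>; in particular \<open>K\<close> is nonempty.
  The quotient in the third condition is taken in \<open>[0,\<infinity>]\<close>, with \<open>a / 0 = \<infinity>\<close> for \<open>a > 0\<close>; its numerator
  never vanishes because of the fourth condition.
\<close>

definition assumption_E ::
    "('a, 'w, 'z) absorbed_process_scheme \<Rightarrow> nat \<Rightarrow> real \<Rightarrow> real \<Rightarrow> real \<Rightarrow> real \<Rightarrow> real \<Rightarrow>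
     ('a \<Rightarrow> real) \<Rightarrow> ('a \<Rightarrow> real) \<Rightarrow> 'a measure \<Rightarrow> 'a set \<Rightarrow> bool" where
  "assumption_E M n1 \<theta>1 \<theta>2 c1 c2 c3 \<phi>1 \<phi>2 \<nu> K \<longleftrightarrow>
     n1 > 0 \<and> \<theta>1 > 0 \<and> \<theta>2 > 0 \<and> c1 > 0 \<and> c2 > 0 \<and> c3 > 0 \<and>
     \<phi>1 \<in> borel_measurable (live M) \<and> (\<forall>x\<in>space (live M). \<phi>1 x \<ge> 0) \<and>
     \<phi>2 \<in> borel_measurable (live M) \<and> (\<forall>x\<in>space (live M). \<phi>2 x \<ge> 0) \<and>
     K \<in> sets (live M) \<and> prob_space \<nu> \<and> sets \<nu> = sets (restrict_space (live M) K) \<and>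
     \<comment> \<open>(E1)\<close>
     (\<forall>x\<in>K. \<forall>A\<in>sets (state_space M). pr_from M x (in_at M n1 A) \<ge> c1 * measure \<nu> (A \<inter> K)) \<and>
     \<comment> \<open>(E2)\<close>
     \<theta>1 < \<theta>2 \<and>
     (\<forall>x\<in>space (live M). \<phi>1 x \<ge> 1) \<and> bdd_above (\<phi>1 ` K) \<and>
     (INF x\<in>K. \<phi>2 x) > 0 \<and> (\<forall>x\<in>space (live M). \<phi>2 x \<le> 1) \<and>
     (\<forall>x\<in>space (live M). semigrp M 1 \<phi>1 x \<le> ennreal (\<theta>1 * \<phi>1 x + c2 * indicator K x)) \<and>
     (\<forall>x\<in>space (live M). semigrp M 1 \<phi>2 x \<ge> ennreal (\<theta>2 * \<phi>2 x)) \<and>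
     \<comment> \<open>(E3)\<close>
     (SUP n. (SUP y\<in>K. ennreal (pr_from M y (alive M n))) /
             (INF y\<in>K. ennreal (pr_from M y (alive M n)))) \<le> ennreal c3 \<and>
     \<comment> \<open>(E4)\<close>
     (\<forall>x\<in>K. \<exists>n4. \<forall>n\<ge>n4. pr_from M x (in_at M n K) > 0)"


section \<open>Quasi-stationary distributions\<close>

text \<open>
  With \<open>a / 0 = 0\<close>, taking \<open>A = E\<close> below forces \<open>P\<^sub>\<mu>(n < \<tau>) > 0\<close>, so the conditioning is meaningful.
\<close>

definition quasi_stationary ::
    "('a, 'w, 'z) absorbed_process_scheme \<Rightarrow> 'a measure \<Rightarrow> bool" where
  "quasi_stationary M \<mu> \<longleftrightarrow>
     prob_space \<mu> \<and> sets \<mu> = sets (live M) \<and>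
     (\<forall>n. \<forall>A\<in>sets (live M).
        pr_init M \<mu> (in_at M n A \<inter> alive M n) / pr_init M \<mu> (alive M n) = measure \<mu> A)"


section \<open>Weighted supremum norms\<close>

definition Linf_norm :: "'a measure \<Rightarrow> ('a \<Rightarrow> real) \<Rightarrow> ('a \<Rightarrow> real) \<Rightarrow> ennreal" where
  "Linf_norm E \<psi> f = (SUP x\<in>space E. ennreal (\<bar>f x\<bar> / \<psi> x))"

definition Linf :: "'a measure \<Rightarrow> ('a \<Rightarrow> real) \<Rightarrow> ('a \<Rightarrow> real) set" where
  "Linf E \<psi> = {f \<in> borel_measurable E. Linf_norm E \<psi> f < \<infinity>}"

definition geometric_convergence ::
    "'a measure \<Rightarrow> ('a \<Rightarrow> real) \<Rightarrow> (nat \<Rightarrow> 'a \<Rightarrow> real) \<Rightarrow> ('a \<Rightarrow> real) \<Rightarrow> bool" where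
  "geometric_convergence E \<psi> h g \<longleftrightarrow>
     (\<forall>n. h n \<in> Linf E \<psi>) \<and> g \<in> Linf E \<psi> \<and>
     (\<exists>C \<alpha>. C > 0 \<and> 0 < \<alpha> \<and> \<alpha> < 1 \<and>
        (\<forall>n. Linf_norm E \<psi> (\<lambda>x. h n x - g x) \<le> ennreal (C * \<alpha> ^ n)))"

end

theory Submission
  imports Defs
begin

text \<open>
  Let \<open>\<kappa>\<^sub>n x\<close> be the law of \<open>X\<^sub>n\<close> under \<open>P\<^sub>x\<close>, restricted to \<open>E\<close>, and let \<open>S\<^sub>n f(x) = \<theta>\<^sub>0\<^sup>-\<^sup>n \<integral> f d\<kappa>\<^sub>n x\<close>.
  These operators form a semigroup on the functions dominated by \<open>\<phi>\<^sub>1\<close>, and the quasi-stationary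
  distribution \<open>\<mu>\<close> is invariant under them.  The functions whose limit is sought are \<open>h\<^sub>n = S\<^sub>n 1\<close>, and
  they satisfy \<open>\<integral> h\<^sub>n d\<mu> = 1\<close>.  Integrating \<open>P\<^sub>1 \<phi>\<^sub>2 \<ge> \<theta>\<^sub>2 \<phi>\<^sub>2\<close> against \<open>\<mu>\<close> gives \<open>\<theta>\<^sub>2 \<le> \<theta>\<^sub>0\<close>, so the drift
  condition on \<open>V = \<phi>\<^sub>1\<close> becomes \<open>S\<^sub>1 V \<le> a V + b 1\<^sub>K\<close> with \<open>a = \<theta>\<^sub>1 / \<theta>\<^sub>0 < 1\<close>.

  Two-sided bounds.  The drift condition forces \<open>\<mu>(K) > 0\<close>, and with \<open>\<integral> h\<^sub>n d\<mu> = 1\<close> the Harnack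
  inequality (E3) bounds \<open>h\<^sub>n\<close> from above on \<open>K\<close>, uniformly in \<open>n\<close>.  The bound spreads from \<open>K\<close> to \<open>E\<close>
  along any function \<open>\<psi> \<ge> 1\<close> with \<open>S\<^sub>1 \<psi> \<le> \<psi>\<close> off \<open>K\<close> (\<open>h_le_superharmonic\<close>): for \<open>\<psi> = V\<close> this is the
  basic estimate \<open>h\<^sub>n \<le> C V\<close>, and for \<open>\<psi> = V\<^sup>p\<close> with \<open>\<theta>\<^sub>1\<^sup>p = \<theta>\<^sub>0\<close> it is the improved growth bound on the
  limit.  Conversely, if \<open>h\<^sub>n\<close> were too small on \<open>K\<close>, the drift condition would make \<open>h\<^sub>n\<^sub>+\<^sub>J / V\<close> small
  everywhere for a fixed \<open>J\<close>, against \<open>\<integral> h\<^sub>n\<^sub>+\<^sub>J d\<mu> = 1\<close>; hence \<open>h\<^sub>n \<ge> \<delta>\<close> on \<open>K\<close> (\<open>h_lower_on_K\<close>).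

  Existence of the eigenfunction, before any convergence.  By the reverse Fatou lemma
  \<open>g = limsup h\<^sub>n\<close> satisfies \<open>g \<le> S\<^sub>1 g\<close>.  Hence \<open>S\<^sub>n g\<close> increases to a function fixed by \<open>S\<^sub>1\<close>, which
  inherits the upper bound by \<open>V\<close> and the lower bound on \<open>K\<close>; normalised by \<open>\<mu>\<close>, it is \<open>\<eta>\<close>
  (\<open>harmonic_function_exists\<close>).

  Convergence.  This is Harris' theorem for a semigroup with harmonic function \<open>\<eta>\<close> in place of
  the constant function.  Where \<open>V \<le> R \<eta>\<close>, a definite fraction of the mass visits \<open>K\<close> in bounded
  time, and (E1) and (E4) then give \<open>S\<^sub>N g \<ge> k \<eta> \<integral> g d\<nu>\<close> for all \<open>g \<ge> 0\<close>
  (\<open>minorisation_on_sublevel_sets\<close>); where \<open>V > R \<eta>\<close>, the drift condition contracts.  Together they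
  show that \<open>S\<^sub>N\<close> contracts the norm \<open>sup |f| / (\<eta> + \<beta> V)\<close> modulo multiples of \<open>\<eta>\<close>
  (\<open>contraction_step\<close>).  Applied repeatedly to \<open>1 - \<eta>\<close>, this leaves a multiple of \<open>\<eta>\<close> that is
  determined up to a geometric error by \<open>\<integral> (h\<^sub>n - \<eta>) d\<mu> = 0\<close>.
\<close>

section \<open>Sub-Markov semigroups on functions dominated by a weight\<close>

text \<open>
  The hypothesis says that the measure \<open>\<mu> \<bind> k\<close> is \<open>c\<close> times \<open>\<mu>\<close>.  With the transition kernel for \<open>k\<close>
  this is the form in which quasi-stationarity is used on functions.
\<close>

lemma nn_integral_eigenmeasure:
  assumes ne: "space \<mu> \<noteq> {}" and sets: "sets \<mu> = sets E"
    and kernel: "k \<in> measurable E (subprob_algebra E)"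
    and eigen: "\<And>A. A \<in> sets E \<Longrightarrow> (\<integral>\<^sup>+x. emeasure (k x) A \<partial>\<mu>) = c * emeasure \<mu> A"
    and f: "f \<in> borel_measurable E"
  shows "(\<integral>\<^sup>+x. (\<integral>\<^sup>+y. f y \<partial>k x) \<partial>\<mu>) = c * (\<integral>\<^sup>+x. f x \<partial>\<mu>)"
proof -
  have k: "k \<in> measurable \<mu> (subprob_algebra E)"
    using kernel by (simp add: measurable_cong_sets[OF sets refl])
  have "\<mu> \<bind> k = scale_measure c \<mu>"
  proof (rule measure_eqI)
    have s: "sets (\<mu> \<bind> k) = sets E"
      using ne by (intro sets_bind sets_kernel[OF k])
    then show "sets (\<mu> \<bind> k) = sets (scale_measure c \<mu>)" by (simp add: sets)
    fix A assume "A \<in> sets (\<mu> \<bind> k)"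
    then have "A \<in> sets E" by (simp add: s)
    then show "emeasure (\<mu> \<bind> k) A = emeasure (scale_measure c \<mu>) A"
      using emeasure_bind[OF ne k] eigen by simp
  qed
  moreover have "f \<in> borel_measurable \<mu>" using f by (simp add: measurable_cong_sets[OF sets refl])
  ultimately show ?thesis
    using nn_integral_bind[OF f k] by (simp add: nn_integral_scale_measure)
qed

text \<open>
  The growth condition on \<open>V\<close> only serves to make \<open>V\<close> integrable for every \<open>\<kappa> n x\<close>.  The number \<open>\<theta>\<close>
  is the rate by which \<open>S\<close> is renormalised below.
\<close>

locale weighted_semigroup =
  fixes E :: "'a measure" and \<kappa> :: "nat \<Rightarrow> 'a \<Rightarrow> 'a measure"
    and V :: "'a \<Rightarrow> real" and \<theta> L :: real
  assumes kernel: "\<kappa> n \<in> measurable E (subprob_algebra E)"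
    and kernel_0: "x \<in> space E \<Longrightarrow> \<kappa> 0 x = return E x"
    and kernel_add: "x \<in> space E \<Longrightarrow> \<kappa> (m + n) x = \<kappa> m x \<bind> \<kappa> n"
    and V_measurable [measurable]: "V \<in> borel_measurable E"
    and V_ge_1: "x \<in> space E \<Longrightarrow> 1 \<le> V x"
    and V_growth: "x \<in> space E \<Longrightarrow> (\<integral>\<^sup>+y. ennreal (V y) \<partial>\<kappa> 1 x) \<le> ennreal (L * V x)"
    and L_nonneg: "0 \<le> L"
    and \<theta>_pos: "0 < \<theta>"
begin

text \<open>
  Membership in \<open>L\<^sup>\<infinity>(V)\<close>, with finite real constants, so that Bochner integrals can be used
  throughout.
\<close>

definition wbdd :: "('a \<Rightarrow> real) \<Rightarrow> bool" where
  "wbdd f \<longleftrightarrow> f \<in> borel_measurable E \<and> (\<exists>c. \<forall>x\<in>space E. \<bar>f x\<bar> \<le> c * V x)"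

definition S :: "nat \<Rightarrow> ('a \<Rightarrow> real) \<Rightarrow> 'a \<Rightarrow> real" where
  "S n f x = (\<integral>y. f y \<partial>\<kappa> n x) / \<theta> ^ n"

lemma sets_\<kappa>: "x \<in> space E \<Longrightarrow> sets (\<kappa> n x) = sets E"
  by (rule sets_kernel[OF kernel])

lemma space_\<kappa>: "x \<in> space E \<Longrightarrow> space (\<kappa> n x) = space E"
  by (rule sets_eq_imp_space_eq[OF sets_\<kappa>])

lemma measurable_\<kappa>:
  "x \<in> space E \<Longrightarrow> f \<in> borel_measurable E \<Longrightarrow> f \<in> borel_measurable (\<kappa> n x)"
  by (simp add: measurable_cong_sets[OF sets_\<kappa> refl])

lemma subprob_\<kappa>: "x \<in> space E \<Longrightarrow> subprob_space (\<kappa> n x)"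
  by (rule subprob_space_kernel[OF kernel])

lemma nn_integral_\<kappa>_add:
  assumes "x \<in> space E" "f \<in> borel_measurable E"
  shows "(\<integral>\<^sup>+y. f y \<partial>\<kappa> (m + n) x) = (\<integral>\<^sup>+y. (\<integral>\<^sup>+z. f z \<partial>\<kappa> n y) \<partial>\<kappa> m x)"
proof -
  have "\<kappa> n \<in> measurable (\<kappa> m x) (subprob_algebra E)"
    using kernel by (simp add: measurable_cong_sets[OF sets_\<kappa>[OF assms(1)] refl])
  then show ?thesis
    by (simp add: kernel_add[OF assms(1)] nn_integral_bind[OF assms(2)])
qed

lemma nn_integral_V_le:
  "x \<in> space E \<Longrightarrow> (\<integral>\<^sup>+y. ennreal (V y) \<partial>\<kappa> n x) \<le> ennreal (L ^ n * V x)"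
proof (induction n arbitrary: x)
  case 0
  then show ?case by (simp add: kernel_0 nn_integral_return)
next
  case (Suc n)
  have "(\<integral>\<^sup>+y. ennreal (V y) \<partial>\<kappa> (1 + n) x)
      = (\<integral>\<^sup>+y. (\<integral>\<^sup>+z. ennreal (V z) \<partial>\<kappa> n y) \<partial>\<kappa> 1 x)"
    using Suc.prems by (intro nn_integral_\<kappa>_add) auto
  also have "\<dots> \<le> (\<integral>\<^sup>+y. ennreal (L ^ n * V y) \<partial>\<kappa> 1 x)"
    by (intro nn_integral_mono Suc.IH) (simp add: space_\<kappa>[OF Suc.prems])
  also have "\<dots> = (\<integral>\<^sup>+y. ennreal (L ^ n) * ennreal (V y) \<partial>\<kappa> 1 x)"
    using L_nonneg by (simp add: ennreal_mult')
  also have "\<dots> = ennreal (L ^ n) * (\<integral>\<^sup>+y. ennreal (V y) \<partial>\<kappa> 1 x)"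
    by (intro nn_integral_cmult measurable_compose[OF measurable_\<kappa>[OF Suc.prems V_measurable]]) auto
  also have "\<dots> \<le> ennreal (L ^ n) * ennreal (L * V x)"
    by (intro mult_left_mono V_growth Suc.prems) auto
  also have "\<dots> = ennreal (L ^ Suc n * V x)"
    using L_nonneg by (simp add: ennreal_mult'[symmetric] mult_ac)
  finally show ?case by simp
qed

lemma wbdd_measurable [measurable_dest]: "wbdd f \<Longrightarrow> f \<in> borel_measurable E"
  by (simp add: wbdd_def)

lemma wbddI: "f \<in> borel_measurable E \<Longrightarrow> (\<And>x. x \<in> space E \<Longrightarrow> \<bar>f x\<bar> \<le> c * V x) \<Longrightarrow> wbdd f"
  by (auto simp: wbdd_def)

lemma wbddE:
  assumes "wbdd f"
  obtains c where "0 \<le> c" "\<And>x. x \<in> space E \<Longrightarrow> \<bar>f x\<bar> \<le> c * V x"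
proof -
  obtain c where c: "\<And>x. x \<in> space E \<Longrightarrow> \<bar>f x\<bar> \<le> c * V x" using assms by (auto simp: wbdd_def)
  show thesis
  proof (rule that[of "max 0 c"])
    fix x assume "x \<in> space E"
    with c[of x] V_ge_1[of x] mult_right_mono[of c "max 0 c" "V x"]
    show "\<bar>f x\<bar> \<le> max 0 c * V x" by linarith
  qed simp
qed

lemma wbdd_const [simp, intro]: "wbdd (\<lambda>_. c)"
proof (rule wbddI[where c="\<bar>c\<bar>"])
  fix x assume "x \<in> space E"
  then show "\<bar>c\<bar> \<le> \<bar>c\<bar> * V x" using V_ge_1[of x] by (simp add: mult_le_cancel_left1)
qed simp

lemma wbdd_V [simp, intro]: "wbdd V"
proof (rule wbddI[where c=1])
  fix x assume "x \<in> space E"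
  then show "\<bar>V x\<bar> \<le> 1 * V x" using V_ge_1[of x] by simp
qed simp

lemma wbdd_cmult [intro]:
  assumes "wbdd f" shows "wbdd (\<lambda>x. r * f x)"
proof -
  obtain c where c: "0 \<le> c" "\<And>x. x \<in> space E \<Longrightarrow> \<bar>f x\<bar> \<le> c * V x" using wbddE[OF assms] by blast
  show ?thesis
    using assms c by (intro wbddI[where c="\<bar>r\<bar> * c"]) (auto simp: abs_mult mult.assoc intro!: mult_left_mono)
qed

lemma wbdd_add [intro]:
  assumes "wbdd f" "wbdd g" shows "wbdd (\<lambda>x. f x + g x)"
proof -
  obtain c where c: "0 \<le> c" "\<And>x. x \<in> space E \<Longrightarrow> \<bar>f x\<bar> \<le> c * V x" using wbddE[OF assms(1)] by blast
  obtain d where d: "0 \<le> d" "\<And>x. x \<in> space E \<Longrightarrow> \<bar>g x\<bar> \<le> d * V x" using wbddE[OF assms(2)] by blast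
  show ?thesis
  proof (rule wbddI[where c="c + d"])
    fix x assume "x \<in> space E"
    then show "\<bar>f x + g x\<bar> \<le> (c + d) * V x" using c(2)[of x] d(2)[of x] by (simp add: algebra_simps)
  qed (use assms in measurable)
qed

lemma wbdd_diff [intro]:
  assumes "wbdd f" "wbdd g" shows "wbdd (\<lambda>x. f x - g x)"
  using wbdd_add[OF assms(1) wbdd_cmult[OF assms(2), of "-1"]] by simp

lemma wbdd_dominated:
  assumes "f \<in> borel_measurable E" "wbdd g" "\<And>x. x \<in> space E \<Longrightarrow> \<bar>f x\<bar> \<le> g x"
  shows "wbdd f"
proof -
  obtain c where "\<And>x. x \<in> space E \<Longrightarrow> \<bar>g x\<bar> \<le> c * V x" using wbddE[OF assms(2)] by blast
  then show ?thesis using assms by (intro wbddI[where c=c]) force+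
qed

lemma wbdd_indicator [intro]:
  assumes "A \<in> sets E" shows "wbdd (indicator A)"
  by (rule wbdd_dominated[OF _ wbdd_const[of 1]]) (use assms in \<open>auto simp: indicator_def\<close>)

lemma wbdd_max_0 [intro]:
  assumes "wbdd f" shows "wbdd (\<lambda>x. max 0 (f x))"
proof -
  obtain c where c: "0 \<le> c" "\<And>x. x \<in> space E \<Longrightarrow> \<bar>f x\<bar> \<le> c * V x" using wbddE[OF assms] by blast
  show ?thesis
  proof (rule wbddI[where c=c])
    fix x assume "x \<in> space E"
    then show "\<bar>max 0 (f x)\<bar> \<le> c * V x" using c(2)[of x] by linarith
  qed (use assms in measurable)
qed

lemma integrable_wbdd:
  assumes "sets N = sets E" "(\<integral>\<^sup>+x. ennreal (V x) \<partial>N) < \<infinity>" "wbdd f"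
  shows "integrable N f"
proof -
  have m: "g \<in> borel_measurable E \<Longrightarrow> g \<in> borel_measurable N" for g :: "'a \<Rightarrow> real"
    by (simp add: measurable_cong_sets[OF assms(1) refl])
  have sp: "space N = space E" by (rule sets_eq_imp_space_eq[OF assms(1)])
  have "(\<integral>\<^sup>+x. ennreal (norm (V x)) \<partial>N) = (\<integral>\<^sup>+x. ennreal (V x) \<partial>N)"
  proof (rule nn_integral_cong)
    fix x assume "x \<in> space N"
    then show "ennreal (norm (V x)) = ennreal (V x)" using V_ge_1[of x] sp by simp
  qed
  then have V: "integrable N V"
    using assms(2) m[OF V_measurable] by (intro integrableI_bounded) auto
  obtain c where "\<And>x. x \<in> space E \<Longrightarrow> \<bar>f x\<bar> \<le> c * V x" using wbddE[OF assms(3)] by blast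
  then show ?thesis
    using V assms(3) by (intro Bochner_Integration.integrable_bound[of N "\<lambda>x. c * V x" f])
      (force simp: sp intro!: m AE_I2)+
qed

lemma integrable_\<kappa>: "x \<in> space E \<Longrightarrow> wbdd f \<Longrightarrow> integrable (\<kappa> n x) f"
  by (rule integrable_wbdd[OF sets_\<kappa>]) (auto intro: le_less_trans[OF nn_integral_V_le])

lemma S_add: "x \<in> space E \<Longrightarrow> wbdd f \<Longrightarrow> wbdd g \<Longrightarrow> S n (\<lambda>y. f y + g y) x = S n f x + S n g x"
  by (simp add: S_def integrable_\<kappa> add_divide_distrib)

lemma S_diff: "x \<in> space E \<Longrightarrow> wbdd f \<Longrightarrow> wbdd g \<Longrightarrow> S n (\<lambda>y. f y - g y) x = S n f x - S n g x"
  by (simp add: S_def integrable_\<kappa> diff_divide_distrib)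

lemma S_cmult: "S n (\<lambda>y. c * f y) x = c * S n f x"
  by (simp add: S_def)

lemma S_mono:
  assumes "x \<in> space E" "wbdd f" "wbdd g" "\<And>y. y \<in> space E \<Longrightarrow> f y \<le> g y"
  shows "S n f x \<le> S n g x"
  unfolding S_def using assms \<theta>_pos
  by (intro divide_right_mono integral_mono integrable_\<kappa>) (auto simp: space_\<kappa>)

lemma S_cong:
  assumes "x \<in> space E" "\<And>y. y \<in> space E \<Longrightarrow> f y = g y"
  shows "S n f x = S n g x"
  unfolding S_def using assms by (auto simp: space_\<kappa> intro!: Bochner_Integration.integral_cong arg_cong2[where f="(/)"])

lemma S_nonneg:
  assumes "x \<in> space E" "\<And>y. y \<in> space E \<Longrightarrow> 0 \<le> f y"
  shows "0 \<le> S n f x"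
  unfolding S_def using assms \<theta>_pos by (auto simp: space_\<kappa> intro!: divide_nonneg_pos integral_nonneg_AE)

lemma S_0: "x \<in> space E \<Longrightarrow> wbdd f \<Longrightarrow> S 0 f x = f x"
  by (simp add: S_def kernel_0 integral_return wbdd_measurable)

lemma S_measurable: "wbdd f \<Longrightarrow> S n f \<in> borel_measurable E"
  unfolding S_def[abs_def]
  by (intro borel_measurable_divide borel_measurable_const
       measurable_compose[OF kernel integral_measurable_subprob_algebra] wbdd_measurable)

lemma wbdd_S [intro]:
  assumes "wbdd f" shows "wbdd (S n f)"
proof -
  obtain c where c: "0 \<le> c" "\<And>x. x \<in> space E \<Longrightarrow> \<bar>f x\<bar> \<le> c * V x" using wbddE[OF assms] by blast
  show ?thesis
  proof (rule wbddI[OF S_measurable[OF assms], where c="c * L ^ n / \<theta> ^ n"])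
    fix x assume x: "x \<in> space E"
    have "ennreal (\<integral>y. V y \<partial>\<kappa> n x) = (\<integral>\<^sup>+y. ennreal (V y) \<partial>\<kappa> n x)"
      using V_ge_1 by (intro nn_integral_eq_integral[symmetric] integrable_\<kappa> x) (force simp: space_\<kappa>[OF x])+
    also have "\<dots> \<le> ennreal (L ^ n * V x)" by (rule nn_integral_V_le[OF x])
    finally have le: "(\<integral>y. V y \<partial>\<kappa> n x) \<le> L ^ n * V x"
      using V_ge_1[OF x] L_nonneg by (simp add: ennreal_le_iff)
    have "\<bar>\<integral>y. f y \<partial>\<kappa> n x\<bar> \<le> (\<integral>y. \<bar>f y\<bar> \<partial>\<kappa> n x)" by (rule integral_abs_bound)
    also have "\<dots> \<le> (\<integral>y. c * V y \<partial>\<kappa> n x)"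
      using assms c by (intro integral_mono integrable_abs integrable_\<kappa> x) (auto simp: space_\<kappa>[OF x])
    also have "\<dots> \<le> c * (L ^ n * V x)" using le c by (simp add: mult_left_mono)
    finally show "\<bar>S n f x\<bar> \<le> c * L ^ n / \<theta> ^ n * V x"
      using \<theta>_pos by (simp add: S_def divide_right_mono mult.assoc)
  qed
qed

lemma ennreal_S:
  assumes "x \<in> space E" "wbdd f" "\<And>y. y \<in> space E \<Longrightarrow> 0 \<le> f y"
  shows "ennreal (S n f x) = ennreal (1 / \<theta> ^ n) * (\<integral>\<^sup>+y. ennreal (f y) \<partial>\<kappa> n x)"
proof -
  have *: "(\<integral>\<^sup>+y. ennreal (f y) \<partial>\<kappa> n x) = ennreal (\<integral>y. f y \<partial>\<kappa> n x)"
    using assms by (intro nn_integral_eq_integral integrable_\<kappa> AE_I2) (auto simp: space_\<kappa>)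
  show ?thesis
    unfolding * S_def using \<theta>_pos
    by (subst ennreal_mult'[symmetric]) (auto simp: field_simps)
qed

text \<open>
  The semigroup law is proved first for nonnegative functions, where Tonelli's theorem for kernels
  needs no integrability, and then extended by splitting into positive and negative parts.
\<close>

lemma S_S_nonneg:
  assumes x: "x \<in> space E" and f: "wbdd f" "\<And>y. y \<in> space E \<Longrightarrow> 0 \<le> f y"
  shows "S (m + n) f x = S m (S n f) x"
proof -
  have "ennreal (S m (S n f) x) = ennreal (1 / \<theta> ^ m) * (\<integral>\<^sup>+y. ennreal (S n f y) \<partial>\<kappa> m x)"
    using f by (intro ennreal_S x) (auto intro: S_nonneg)
  also have "(\<integral>\<^sup>+y. ennreal (S n f y) \<partial>\<kappa> m x)
      = (\<integral>\<^sup>+y. ennreal (1 / \<theta> ^ n) * (\<integral>\<^sup>+z. ennreal (f z) \<partial>\<kappa> n y) \<partial>\<kappa> m x)"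
    using f by (intro nn_integral_cong ennreal_S) (auto simp: space_\<kappa>[OF x])
  also have "\<dots> = ennreal (1 / \<theta> ^ n) * (\<integral>\<^sup>+y. (\<integral>\<^sup>+z. ennreal (f z) \<partial>\<kappa> n y) \<partial>\<kappa> m x)"
  proof (rule nn_integral_cmult)
    show "(\<lambda>y. \<integral>\<^sup>+z. ennreal (f z) \<partial>\<kappa> n y) \<in> borel_measurable (\<kappa> m x)"
      using f by (intro measurable_\<kappa>[OF x] measurable_compose[OF kernel nn_integral_measurable_subprob_algebra])
        (auto dest!: wbdd_measurable)
  qed
  also have "(\<integral>\<^sup>+y. (\<integral>\<^sup>+z. ennreal (f z) \<partial>\<kappa> n y) \<partial>\<kappa> m x) = (\<integral>\<^sup>+z. ennreal (f z) \<partial>\<kappa> (m + n) x)"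
    using f by (intro nn_integral_\<kappa>_add[symmetric] x) (auto dest!: wbdd_measurable)
  also have "ennreal (1 / \<theta> ^ m) * (ennreal (1 / \<theta> ^ n) * \<dots>) = ennreal (1 / \<theta> ^ (m + n)) * \<dots>"
    using \<theta>_pos by (simp add: mult.assoc[symmetric] ennreal_mult'[symmetric] power_add)
  also have "\<dots> = ennreal (S (m + n) f x)" using f by (intro ennreal_S[symmetric] x) auto
  finally show ?thesis
    using f x by (subst (asm) ennreal_inj) (auto intro!: S_nonneg)
qed

lemma S_S:
  assumes x: "x \<in> space E" and f: "wbdd f"
  shows "S (m + n) f x = S m (S n f) x"
proof -
  let ?p = "\<lambda>y. max 0 (f y)" and ?q = "\<lambda>y. max 0 (- f y)"
  have q: "wbdd ?q" using wbdd_max_0[OF wbdd_cmult[OF f, of "-1"]] by simp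
  have p: "wbdd ?p" using f by auto
  have split: "f = (\<lambda>y. ?p y - ?q y)" by (auto simp: max_def fun_eq_iff)
  have "S m (S n f) x = S m (\<lambda>y. S n ?p y - S n ?q y) x"
    using p q by (intro S_cong x) (subst split, rule S_diff)
  also have "\<dots> = S m (S n ?p) x - S m (S n ?q) x" using p q by (intro S_diff x) auto
  also have "\<dots> = S (m + n) ?p x - S (m + n) ?q x" using p q x by (simp add: S_S_nonneg)
  also have "\<dots> = S (m + n) f x" using S_diff[OF x p q, of "m + n"] split by metis
  finally show ?thesis by simp
qed

lemma S_abs_le:
  assumes x: "x \<in> space E" and f: "wbdd f" "wbdd g" "\<And>y. y \<in> space E \<Longrightarrow> \<bar>f y\<bar> \<le> g y"
  shows "\<bar>S n f x\<bar> \<le> S n g x"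
proof -
  have "S n f x \<le> S n g x" using f by (intro S_mono x) (auto simp: abs_le_iff)
  moreover have "S n (\<lambda>y. - 1 * f y) x \<le> S n g x" using f by (intro S_mono x wbdd_cmult) (auto simp: abs_le_iff)
  ultimately show ?thesis unfolding S_cmult by auto
qed

text \<open>
  Dominated convergence: a bound by a multiple of \<open>V\<close> is an integrable bound for every kernel.
\<close>

lemma S_tendsto:
  assumes x: "x \<in> space E" and F: "\<And>i. F i \<in> borel_measurable E" and f: "f \<in> borel_measurable E"
    and bd: "\<And>i y. y \<in> space E \<Longrightarrow> \<bar>F i y\<bar> \<le> c * V y"
    and lim: "\<And>y. y \<in> space E \<Longrightarrow> (\<lambda>i. F i y) \<longlonglongrightarrow> f y"
  shows "(\<lambda>i. S n (F i) x) \<longlonglongrightarrow> S n f x"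
  unfolding S_def using \<theta>_pos
proof (intro tendsto_divide tendsto_const)
  show "(\<lambda>i. \<integral>y. F i y \<partial>\<kappa> n x) \<longlonglongrightarrow> (\<integral>y. f y \<partial>\<kappa> n x)"
    using x F f bd lim
    by (intro integral_dominated_convergence[where w="\<lambda>y. c * V y"] integrable_\<kappa> wbdd_cmult wbdd_V
          measurable_\<kappa> AE_I2) (auto simp: space_\<kappa>)
qed simp

end

section \<open>Bounds on the renormalised survival probabilities\<close>

text \<open>
  Here \<open>\<mu>\<close> is the quasi-stationary distribution and \<open>\<theta>\<close> its decay parameter.  The drift condition
  already contains the comparison of rates: \<open>a\<close> stands for \<open>\<theta>\<^sub>1 / \<theta>\<^sub>0\<close>.  The measure \<open>\<nu>\<close> is carried to
  \<open>E\<close>, and its support property is \<open>\<nu>_K\<close>.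
\<close>

locale quasi_stationary_semigroup = weighted_semigroup +
  fixes \<mu> \<nu> :: "'a measure" and K :: "'a set" and a b c1 c3 v :: real and n1 :: nat
  assumes prob_\<mu>: "prob_space \<mu>" and sets_\<mu>: "sets \<mu> = sets E"
    and \<mu>_kernel: "A \<in> sets E \<Longrightarrow> (\<integral>\<^sup>+x. emeasure (\<kappa> n x) A \<partial>\<mu>) = ennreal (\<theta> ^ n) * emeasure \<mu> A"
    and \<mu>_V: "(\<integral>\<^sup>+x. ennreal (V x) \<partial>\<mu>) < \<infinity>"
    and \<theta>_le_1: "\<theta> \<le> 1"
    and K_sets [measurable]: "K \<in> sets E"
    and a_nonneg: "0 \<le> a" and a_less_1: "a < 1" and b_nonneg: "0 \<le> b"
    and drift: "x \<in> space E \<Longrightarrow> S 1 V x \<le> a * V x + b * indicator K x"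
    and c3_pos: "0 < c3"
    and harnack: "x \<in> K \<Longrightarrow> y \<in> K \<Longrightarrow> S n (\<lambda>_. 1) x \<le> c3 * S n (\<lambda>_. 1) y"
    and V_on_K: "x \<in> K \<Longrightarrow> V x \<le> v"
    and prob_\<nu>: "prob_space \<nu>" and sets_\<nu>: "sets \<nu> = sets E" and \<nu>_K: "AE x in \<nu>. x \<in> K"
    and c1_pos: "0 < c1"
    and minorisation:
      "x \<in> K \<Longrightarrow> A \<in> sets E \<Longrightarrow> ennreal c1 * emeasure \<nu> A \<le> emeasure (\<kappa> n1 x) A"
    and aperiodic: "x \<in> K \<Longrightarrow> \<exists>n4. \<forall>n\<ge>n4. 0 < S n (indicator K) x"
begin

abbreviation h :: "nat \<Rightarrow> 'a \<Rightarrow> real" where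
  "h n \<equiv> S n (\<lambda>_. 1)"

lemma K_space: "x \<in> K \<Longrightarrow> x \<in> space E"
  using sets.sets_into_space[OF K_sets] by auto

lemma space_\<mu>: "space \<mu> = space E" by (rule sets_eq_imp_space_eq[OF sets_\<mu>])

lemma space_\<nu>: "space \<nu> = space E" by (rule sets_eq_imp_space_eq[OF sets_\<nu>])

lemma integrable_\<mu>: "wbdd f \<Longrightarrow> integrable \<mu> f"
  by (rule integrable_wbdd[OF sets_\<mu> \<mu>_V])

lemma integrable_\<nu>:
  assumes "wbdd f" shows "integrable \<nu> f"
proof (rule integrable_wbdd[OF sets_\<nu> _ assms])
  have "(\<integral>\<^sup>+x. ennreal (V x) \<partial>\<nu>) \<le> (\<integral>\<^sup>+x. ennreal v \<partial>\<nu>)"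
    using \<nu>_K by (intro nn_integral_mono_AE) (auto elim!: eventually_mono intro: ennreal_leI V_on_K)
  also have "\<dots> = ennreal v" using prob_space.emeasure_space_1[OF prob_\<nu>] by simp
  finally show "(\<integral>\<^sup>+x. ennreal (V x) \<partial>\<nu>) < \<infinity>" by (auto simp: le_less_trans)
qed

lemma \<mu>_mono:
  assumes "wbdd f" "wbdd g" "\<And>x. x \<in> space E \<Longrightarrow> f x \<le> g x"
  shows "(\<integral>x. f x \<partial>\<mu>) \<le> (\<integral>x. g x \<partial>\<mu>)"
  using assms by (intro integral_mono integrable_\<mu>) (auto simp: space_\<mu>)

lemma nn_integral_\<mu>_kernel:
  "f \<in> borel_measurable E \<Longrightarrow>
    (\<integral>\<^sup>+x. (\<integral>\<^sup>+y. f y \<partial>\<kappa> n x) \<partial>\<mu>) = ennreal (\<theta> ^ n) * (\<integral>\<^sup>+x. f x \<partial>\<mu>)"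
  by (rule nn_integral_eigenmeasure[OF prob_space.not_empty[OF prob_\<mu>] sets_\<mu> kernel \<mu>_kernel])

lemma \<mu>_S_nonneg:
  assumes f: "wbdd f" "\<And>y. y \<in> space E \<Longrightarrow> 0 \<le> f y"
  shows "(\<integral>x. S n f x \<partial>\<mu>) = (\<integral>x. f x \<partial>\<mu>)"
proof -
  have "ennreal (\<integral>x. S n f x \<partial>\<mu>) = (\<integral>\<^sup>+x. ennreal (S n f x) \<partial>\<mu>)"
    using f by (intro nn_integral_eq_integral[symmetric] integrable_\<mu>) (auto simp: space_\<mu> intro!: S_nonneg AE_I2)
  also have "\<dots> = (\<integral>\<^sup>+x. ennreal (1 / \<theta> ^ n) * (\<integral>\<^sup>+y. ennreal (f y) \<partial>\<kappa> n x) \<partial>\<mu>)"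
    using f by (intro nn_integral_cong ennreal_S) (auto simp: space_\<mu>)
  also have "\<dots> = ennreal (1 / \<theta> ^ n) * (\<integral>\<^sup>+x. (\<integral>\<^sup>+y. ennreal (f y) \<partial>\<kappa> n x) \<partial>\<mu>)"
  proof (rule nn_integral_cmult)
    have "(\<lambda>x. \<integral>\<^sup>+y. ennreal (f y) \<partial>\<kappa> n x) \<in> borel_measurable E"
      using f by (intro measurable_compose[OF kernel nn_integral_measurable_subprob_algebra])
        (auto dest!: wbdd_measurable)
    then show "(\<lambda>x. \<integral>\<^sup>+y. ennreal (f y) \<partial>\<kappa> n x) \<in> borel_measurable \<mu>"
      by (simp add: measurable_cong_sets[OF sets_\<mu> refl])
  qed
  also have "\<dots> = ennreal (1 / \<theta> ^ n) * (ennreal (\<theta> ^ n) * (\<integral>\<^sup>+x. ennreal (f x) \<partial>\<mu>))"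
    using f by (subst nn_integral_\<mu>_kernel) (auto dest!: wbdd_measurable)
  also have "\<dots> = (\<integral>\<^sup>+x. ennreal (f x) \<partial>\<mu>)"
    using \<theta>_pos by (simp add: mult.assoc[symmetric] ennreal_mult'[symmetric])
  also have "\<dots> = ennreal (\<integral>x. f x \<partial>\<mu>)"
    using f by (intro nn_integral_eq_integral integrable_\<mu>) (auto simp: space_\<mu>)
  finally show ?thesis
    using f by (subst (asm) ennreal_inj) (auto intro!: integral_nonneg_AE S_nonneg simp: space_\<mu>)
qed

lemma \<mu>_S:
  assumes f: "wbdd f"
  shows "(\<integral>x. S n f x \<partial>\<mu>) = (\<integral>x. f x \<partial>\<mu>)"
proof -
  let ?p = "\<lambda>y. max 0 (f y)" and ?q = "\<lambda>y. max 0 (- f y)"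
  have q: "wbdd ?q" using wbdd_max_0[OF wbdd_cmult[OF f, of "-1"]] by simp
  have p: "wbdd ?p" using f by auto
  have split: "f = (\<lambda>y. ?p y - ?q y)" by (auto simp: max_def fun_eq_iff)
  have "(\<integral>x. S n f x \<partial>\<mu>) = (\<integral>x. S n ?p x - S n ?q x \<partial>\<mu>)"
    using p q by (intro Bochner_Integration.integral_cong refl) (subst split, auto simp: space_\<mu> intro!: S_diff)
  also have "\<dots> = (\<integral>x. S n ?p x \<partial>\<mu>) - (\<integral>x. S n ?q x \<partial>\<mu>)"
    using p q by (intro Bochner_Integration.integral_diff integrable_\<mu>) auto
  also have "\<dots> = (\<integral>x. ?p x \<partial>\<mu>) - (\<integral>x. ?q x \<partial>\<mu>)"
    using p q by (simp add: \<mu>_S_nonneg)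
  also have "\<dots> = (\<integral>x. ?p x - ?q x \<partial>\<mu>)"
    using p q by (intro Bochner_Integration.integral_diff[symmetric] integrable_\<mu>) auto
  finally show ?thesis using split by simp
qed

lemma \<mu>_const: "(\<integral>x. c \<partial>\<mu>) = (c::real)"
  using prob_space.emeasure_space_1[OF prob_\<mu>] by (simp add: measure_def)

lemma \<mu>_h: "(\<integral>x. h n x \<partial>\<mu>) = 1"
  by (simp only: \<mu>_S[OF wbdd_const] \<mu>_const)

lemma h_nonneg: "x \<in> space E \<Longrightarrow> 0 \<le> h n x"
  by (auto intro: S_nonneg)

lemma \<mu>_V_ge_1: "1 \<le> (\<integral>x. V x \<partial>\<mu>)"
  using \<mu>_mono[of "\<lambda>_. 1" V] V_ge_1 unfolding \<mu>_const by auto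

text \<open>
  If \<open>\<mu>(K)\<close> were zero, the drift condition would give \<open>\<integral> V d\<mu> \<le> a \<integral> V d\<mu>\<close> by invariance,
  although \<open>\<integral> V d\<mu>\<close> is finite and at least one.
\<close>

lemma measure_\<mu>_K: "0 < measure \<mu> K"
proof -
  have "(\<integral>x. V x \<partial>\<mu>) = (\<integral>x. S 1 V x \<partial>\<mu>)" by (simp add: \<mu>_S)
  also have "\<dots> \<le> (\<integral>x. a * V x + b * indicator K x \<partial>\<mu>)"
    by (intro \<mu>_mono wbdd_add wbdd_cmult wbdd_indicator wbdd_S K_sets drift wbdd_V)
  also have "\<dots> = a * (\<integral>x. V x \<partial>\<mu>) + b * measure \<mu> K"
    by (subst Bochner_Integration.integral_add)
       (auto intro!: integrable_\<mu> wbdd_cmult wbdd_indicator simp: integrable_\<mu> sets_\<mu> space_\<mu> K_space Int_absorb2 subset_iff)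
  finally have "(1 - a) * (\<integral>x. V x \<partial>\<mu>) \<le> b * measure \<mu> K" by (simp add: algebra_simps)
  moreover have "0 < (1 - a) * (\<integral>x. V x \<partial>\<mu>)" using a_less_1 \<mu>_V_ge_1 by (intro mult_pos_pos) auto
  ultimately have "0 < b * measure \<mu> K" by linarith
  then show ?thesis using b_nonneg by (simp add: zero_less_mult_iff)
qed

definition h_bound :: real where "h_bound = c3 / measure \<mu> K"

text \<open>
  By the Harnack inequality \<open>c3 h\<^sub>n\<close> is at least \<open>h\<^sub>n(x)\<close> on all of \<open>K\<close>; compare with \<open>\<integral> h\<^sub>n d\<mu> = 1\<close>.
\<close>

lemma h_le_on_K:
  assumes x: "x \<in> K" shows "h n x \<le> h_bound"
proof -
  have "measure \<mu> K * h n x = (\<integral>y. h n x * indicator K y \<partial>\<mu>)"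
    using K_sets by (simp add: sets_\<mu> space_\<mu> K_space Int_absorb2 subset_iff)
  also have "\<dots> \<le> (\<integral>y. c3 * h n y \<partial>\<mu>)"
  proof (intro \<mu>_mono wbdd_cmult wbdd_indicator K_sets wbdd_S wbdd_const)
    fix y assume "y \<in> space E"
    then show "h n x * indicator K y \<le> c3 * h n y"
      using harnack[OF x, of y] h_nonneg[of y n] c3_pos by (auto simp: indicator_def)
  qed
  also have "\<dots> = c3" by (simp add: \<mu>_h)
  finally show ?thesis using measure_\<mu>_K by (simp add: h_bound_def field_simps)
qed

lemma h_add: "x \<in> space E \<Longrightarrow> h (k + n) x = S k (h n) x"
  by (simp add: S_S)

lemma h_Suc: "x \<in> space E \<Longrightarrow> h (Suc n) x = S 1 (h n) x"
  using h_add[of x 1 n] by simp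

text \<open>
  Induction on \<open>n\<close>: on \<open>K\<close> the uniform bound is available and \<open>\<psi> \<ge> 1\<close>, and off \<open>K\<close> the inequality for
  \<open>n\<close> is preserved by \<open>S 1\<close>.  Restarting from \<open>K\<close> avoids any summation over excursions.
\<close>

lemma h_le_superharmonic:
  assumes \<psi>: "wbdd \<psi>" "\<And>x. x \<in> space E \<Longrightarrow> 1 \<le> \<psi> x"
    and super: "\<And>x. x \<in> space E \<Longrightarrow> x \<notin> K \<Longrightarrow> S 1 \<psi> x \<le> \<psi> x"
    and x: "x \<in> space E"
  shows "h n x \<le> max 1 h_bound * \<psi> x"
  using x
proof (induction n arbitrary: x)
  case 0
  have "1 * 1 \<le> max 1 h_bound * \<psi> x" using \<psi>(2)[OF 0] by (intro mult_mono) auto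
  then show ?case using 0 by (simp add: S_0)
next
  case (Suc n)
  show ?case
  proof (cases "x \<in> K")
    case True
    have "h (Suc n) x \<le> h_bound * 1" using h_le_on_K[OF True] by simp
    also have "\<dots> \<le> max 1 h_bound * \<psi> x" using \<psi>(2)[OF Suc.prems] by (intro mult_mono) auto
    finally show ?thesis .
  next
    case False
    have "h (Suc n) x \<le> S 1 (\<lambda>y. max 1 h_bound * \<psi> y) x"
      unfolding h_Suc[OF Suc.prems] using \<psi> Suc by (intro S_mono) auto
    also have "\<dots> \<le> max 1 h_bound * \<psi> x" unfolding S_cmult using super[OF Suc.prems False] by (intro mult_left_mono) auto
    finally show ?thesis .
  qed
qed

lemma drift_off_K: "x \<in> space E \<Longrightarrow> x \<notin> K \<Longrightarrow> S 1 V x \<le> a * V x"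
  using drift[of x] by simp

lemma h_le_V: "x \<in> space E \<Longrightarrow> h n x \<le> max 1 h_bound * V x"
proof (rule h_le_superharmonic)
  fix x assume x: "x \<in> space E" "x \<notin> K"
  have "a * V x \<le> 1 * V x" using a_less_1 V_ge_1[OF x(1)] by (intro mult_right_mono) auto
  with drift_off_K[OF x] show "S 1 V x \<le> V x" by simp
qed (auto intro: V_ge_1)

lemma h_decay:
  assumes "x \<in> space E" shows "h (n + j) x \<le> h n x / \<theta> ^ j"
proof -
  have le: "h j y \<le> 1 / \<theta> ^ j" if "y \<in> space E" for y
    unfolding S_def using \<theta>_pos subprob_space.subprob_measure_le_1[OF subprob_\<kappa>[OF that]]
    by (intro divide_right_mono) auto
  have "h (n + j) x \<le> S n (\<lambda>_. (1 / \<theta> ^ j) * 1) x"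
    unfolding h_add[OF assms] using le by (intro S_mono assms) auto
  also have "\<dots> = h n x / \<theta> ^ j" unfolding S_cmult by simp
  finally show ?thesis .
qed

text \<open>
  For an exponent \<open>p \<le> 1\<close> with \<open>(\<theta> a)\<^sup>p \<le> \<theta>\<close>, the function \<open>V\<^sup>p\<close> is superharmonic off \<open>K\<close>.  This is
  Jensen's inequality for the sub-probability kernel; it is obtained by bounding the concave power
  by its tangent at \<open>T = \<theta> a V x\<close>, an upper bound for the unnormalised mean of \<open>V\<close> after one step.
\<close>

lemma h_le_V_powr:
  assumes a: "0 < a" and p: "0 \<le> p" "p \<le> 1" "(\<theta> * a) powr p \<le> \<theta>" and x: "x \<in> space E"
  shows "h n x \<le> max 1 h_bound * V x powr p"
proof (rule h_le_superharmonic[OF _ _ _ x])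
  show one_le: "1 \<le> V y powr p" if "y \<in> space E" for y
    using V_ge_1[OF that] p by (intro ge_one_powr_ge_zero) auto
  show wb: "wbdd (\<lambda>y. V y powr p)"
  proof (rule wbdd_dominated[OF _ wbdd_V])
    fix y assume y: "y \<in> space E"
    show "\<bar>V y powr p\<bar> \<le> V y" using V_ge_1[OF y] p powr_mono[of p 1 "V y"] by simp
  qed measurable
  fix x assume x: "x \<in> space E" "x \<notin> K"
  define T where "T = \<theta> * a * V x"
  have T: "0 < T" using \<theta>_pos a V_ge_1[OF x(1)] by (simp add: T_def)
  \<comment> \<open>\<open>c p\<close> is the slope of the tangent of \<open>z \<mapsto> z\<^sup>p\<close> at \<open>T\<close>.\<close>
  define c where "c = T powr (p - 1)"
  have c: "0 < c" "c * T = T powr p" "c * T powr (1 - p) = 1"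
    using T by (simp_all add: c_def powr_mult_base powr_add[symmetric] mult.commute)
  have le: "V y powr p \<le> c * p * V y + c * (1 - p) * T" if y: "y \<in> space E" for y
  proof -
    have "V y powr p = c * (V y powr p * T powr (1 - p))" using c(3) by simp
    also have "\<dots> \<le> c * (p * V y + (1 - p) * T)"
      using c(1) p T V_ge_1[OF y] by (intro mult_left_mono Youngs_inequality_0) auto
    finally show ?thesis by (simp add: algebra_simps)
  qed
  have "S 1 (\<lambda>y. V y powr p) x \<le> S 1 (\<lambda>y. c * p * V y + c * (1 - p) * T * 1) x"
    using le by (intro S_mono x wb wbdd_add wbdd_cmult wbdd_V wbdd_const) auto
  also have "\<dots> = c * p * S 1 V x + c * (1 - p) * T * h 1 x"
    using x by (subst S_add) (auto simp only: S_cmult intro!: wbdd_cmult wbdd_V wbdd_const)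
  also have "\<dots> \<le> c * p * (T / \<theta>) + c * (1 - p) * T * (1 / \<theta>)"
  proof (intro add_mono mult_left_mono)
    show "S 1 V x \<le> T / \<theta>" using drift_off_K[OF x] \<theta>_pos by (simp add: T_def)
    show "h 1 x \<le> 1 / \<theta>" using h_decay[OF x(1), of 0 1] x(1) by (simp add: S_0)
  qed (use c p T in auto)
  also have "\<dots> = c * T / \<theta>" by (simp add: algebra_simps add_divide_distrib[symmetric])
  also have "\<dots> = (\<theta> * a) powr p / \<theta> * V x powr p"
    unfolding c(2) using \<theta>_pos a V_ge_1[OF x(1)] by (simp add: T_def powr_mult)
  also have "\<dots> \<le> 1 * V x powr p" using p \<theta>_pos by (intro mult_right_mono) auto
  finally show "S 1 (\<lambda>y. V y powr p) x \<le> V x powr p" by simp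
qed

text \<open>
  Let \<open>t\<close> bound \<open>h n\<close> on \<open>K\<close>.  Survival probabilities decrease, so \<open>h (n + j) \<le> t / \<theta>\<^sup>j\<close> on \<open>K\<close>, whereas
  off \<open>K\<close> the ratio of \<open>h (n + j)\<close> to \<open>V\<close> gains a factor \<open>a\<close> at each step.  For a \<open>J\<close> that depends only
  on the constants, the contribution of the factor \<open>a\<^sup>J\<close> to \<open>\<integral> h (n + J) d\<mu> = 1\<close> is less than one, so
  \<open>t / \<theta>\<^sup>J\<close> cannot be small.
\<close>

lemma h_lower_on_K: "\<exists>\<delta>>0. \<forall>n. \<forall>x\<in>K. \<delta> \<le> h n x"
proof -
  let ?C = "max 1 h_bound" and ?W = "\<integral>x. V x \<partial>\<mu>"
  have W: "1 \<le> ?W" by (rule \<mu>_V_ge_1)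
  have "(\<lambda>j. a ^ j * (?C * ?W)) \<longlonglongrightarrow> 0 * (?C * ?W)"
    using a_nonneg a_less_1 by (intro tendsto_mult LIMSEQ_realpow_zero tendsto_const)
  then have "\<forall>\<^sub>F j in sequentially. a ^ j * (?C * ?W) < 1"
    by (intro order_tendstoD(2)) auto
  then obtain J where J: "a ^ J * (?C * ?W) < 1" by (auto simp: eventually_sequentially)
  have "\<theta> ^ J / (c3 * ?W) \<le> h n x" if x: "x \<in> K" for n x
  proof -
    define t where "t = c3 * h n x"
    have t: "0 \<le> t" using c3_pos h_nonneg[OF K_space[OF x]] by (simp add: t_def)
    \<comment> \<open>The second entry of the maximum takes over at points of \<open>K\<close>, the first one decays off \<open>K\<close>.\<close>
    have claim: "h (n + j) y \<le> max (a ^ j * ?C) (t / \<theta> ^ j) * V y" if "y \<in> space E" for j y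
      using that
    proof (induction j arbitrary: y)
      case 0
      have "?C * V y \<le> max ?C t * V y" using V_ge_1[OF 0] by (intro mult_right_mono) auto
      then show ?case using h_le_V[OF 0, of n] by (auto intro: order_trans)
    next
      case (Suc j)
      let ?M = "max (a ^ Suc j * ?C) (t / \<theta> ^ Suc j)"
      show ?case
      proof (cases "y \<in> K")
        case True
        have "h (n + Suc j) y \<le> h n y / \<theta> ^ Suc j" by (rule h_decay[OF Suc.prems])
        also have "\<dots> \<le> t / \<theta> ^ Suc j * 1"
          using harnack[OF True x, of n] \<theta>_pos by (auto simp: t_def intro!: divide_right_mono)
        also have "\<dots> \<le> ?M * V y"
          using V_ge_1[OF Suc.prems] t \<theta>_pos by (intro mult_mono) (auto intro: max.coboundedI2)
        finally show ?thesis .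
      next
        case False
        let ?M' = "max (a ^ j * ?C) (t / \<theta> ^ j)"
        have M': "0 \<le> ?M'" using t \<theta>_pos by (intro max.coboundedI2) auto
        have "h (n + Suc j) y = S 1 (h (n + j)) y" using h_Suc[OF Suc.prems, of "n + j"] by simp
        also have "\<dots> \<le> S 1 (\<lambda>z. ?M' * V z) y"
          using Suc by (intro S_mono wbdd_S wbdd_cmult wbdd_V wbdd_const) auto
        also have "\<dots> \<le> ?M' * (a * V y)"
          unfolding S_cmult using drift_off_K[OF Suc.prems False] M' by (intro mult_left_mono)
        also have "\<dots> = (a * ?M') * V y" by simp
        also have "a * ?M' \<le> ?M"
        proof -
          have "a * (t / \<theta> ^ j) \<le> (1 / \<theta>) * (t / \<theta> ^ j)"
            using a_less_1 \<theta>_le_1 \<theta>_pos t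
            by (intro mult_right_mono order_trans[of a 1 "1 / \<theta>"]) auto
          also have "\<dots> = t / \<theta> ^ Suc j" by simp
          finally show ?thesis using a_nonneg by (auto simp: max_mult_distrib_left mult.assoc)
        qed
        then have "(a * ?M') * V y \<le> ?M * V y" using V_ge_1[OF Suc.prems] by (intro mult_right_mono) auto
        finally show ?thesis .
      qed
    qed
    have "1 = (\<integral>y. h (n + J) y \<partial>\<mu>)" by (simp add: \<mu>_h)
    also have "\<dots> \<le> (\<integral>y. max (a ^ J * ?C) (t / \<theta> ^ J) * V y \<partial>\<mu>)"
      by (intro \<mu>_mono wbdd_S wbdd_const wbdd_cmult wbdd_V claim)
    also have "\<dots> = max (a ^ J * ?C) (t / \<theta> ^ J) * ?W" by simp
    finally have "1 \<le> max (a ^ J * (?C * ?W)) (t / \<theta> ^ J * ?W)"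
      using W by (auto simp: max_mult_distrib_right mult.assoc)
    with J have "1 \<le> t / \<theta> ^ J * ?W" by (simp add: le_max_iff_disj)
    then show ?thesis using \<theta>_pos c3_pos W by (simp add: t_def field_simps)
  qed
  moreover have "0 < \<theta> ^ J / (c3 * ?W)" using \<theta>_pos c3_pos W by (intro divide_pos_pos mult_pos_pos) auto
  ultimately show ?thesis by blast
qed

lemma S_indicator_le_h: "x \<in> space E \<Longrightarrow> S n (indicator K) x \<le> h n x"
  by (intro S_mono wbdd_indicator K_sets wbdd_const) (auto simp: indicator_def)

lemma S_Suc_V_le:
  assumes "x \<in> space E"
  shows "S (Suc n) V x \<le> a * S n V x + b * S n (indicator K) x"
proof -
  have "S (Suc n) V x = S n (S 1 V) x" using S_S[OF assms wbdd_V, of n 1] by simp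
  also have "\<dots> \<le> S n (\<lambda>y. a * V y + b * indicator K y) x"
    by (intro S_mono assms wbdd_add wbdd_cmult wbdd_indicator wbdd_S K_sets drift wbdd_V)
  also have "\<dots> = a * S n V x + b * S n (indicator K) x"
    by (subst S_add) (auto simp: S_cmult assms intro!: wbdd_cmult wbdd_indicator)
  finally show ?thesis .
qed

text \<open>
  The mass that the drift condition adds at time \<open>n\<close> is \<open>b S\<^sub>n 1\<^sub>K \<le> b h\<^sub>n\<close>, which is a bounded multiple of
  \<open>V\<close>; a geometric series in \<open>a\<close> sums it up.
\<close>

lemma S_V_bounded: "\<exists>D\<ge>1. \<forall>n. \<forall>x\<in>space E. S n V x \<le> D * V x"
proof -
  \<comment> \<open>The fixed point of the recursion for the excess over \<open>V\<close>.\<close>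
  define C where "C = b * max 1 h_bound / (1 - a)"
  have C: "0 \<le> C" "a * C + b * max 1 h_bound = C"
    using a_less_1 b_nonneg by (auto simp: C_def field_simps)
  have "S n V x \<le> (1 + C) * V x" if x: "x \<in> space E" for n x
  proof (induction n)
    case 0
    have "1 * V x \<le> (1 + C) * V x" using C V_ge_1[OF x] by (intro mult_right_mono) auto
    then show ?case using x by (simp add: S_0)
  next
    case (Suc n)
    have "S (Suc n) V x \<le> a * ((1 + C) * V x) + b * (max 1 h_bound * V x)"
      using S_Suc_V_le[OF x, of n] Suc a_nonneg b_nonneg
        S_indicator_le_h[OF x, of n] h_le_V[OF x, of n]
      by (smt (verit) mult_left_mono)
    also have "\<dots> = (a + (a * C + b * max 1 h_bound)) * V x" by (simp add: algebra_simps)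
    also have "\<dots> \<le> (1 + C) * V x"
      unfolding C(2) using a_less_1 V_ge_1[OF x] by (intro mult_right_mono) auto
    finally show ?case .
  qed
  then show ?thesis using C by (intro exI[of _ "1 + C"]) auto
qed

section \<open>Existence of a positive harmonic function\<close>

text \<open>
  The upper limit \<open>g\<close> of the \<open>h n\<close> is subharmonic by the reverse Fatou lemma, carried out here with
  the decreasing envelopes \<open>w n = sup\<^sub>k h (n + k)\<close>.  The increasing limit \<open>\<zeta>\<close> of \<open>S n g\<close> is harmonic.
  The upper limit is the right choice: it is the lower bound on \<open>K\<close> that has to survive the second
  passage to the limit, and it does so because that limit is increasing.
\<close>

lemma harmonic_function_exists:
  "\<exists>\<eta> C \<delta>. wbdd \<eta> \<and> (\<forall>x\<in>space E. 0 \<le> \<eta> x) \<and> (\<forall>x\<in>space E. S 1 \<eta> x = \<eta> x) \<and>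
     (\<forall>x\<in>space E. \<eta> x \<le> C * V x) \<and> 0 < \<delta> \<and> (\<forall>x\<in>K. \<delta> \<le> \<eta> x) \<and> (\<integral>x. \<eta> x \<partial>\<mu>) = 1"
proof -
  obtain \<delta> where \<delta>: "0 < \<delta>" "\<And>n x. x \<in> K \<Longrightarrow> \<delta> \<le> h n x" using h_lower_on_K by blast
  obtain D where D: "1 \<le> D" "\<And>n x. x \<in> space E \<Longrightarrow> S n V x \<le> D * V x" using S_V_bounded by blast
  define C where "C = max 1 h_bound"
  have C: "1 \<le> C" "\<And>n x. x \<in> space E \<Longrightarrow> h n x \<le> C * V x" using h_le_V by (auto simp: C_def)
  define w where "w n x = (SUP k. h (n + k) x)" for n x
  define g where "g x = (INF n. w n x)" for x
  have bdd_h: "bdd_above (range (\<lambda>k. h (n + k) x))" if "x \<in> space E" for n x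
    using C(2)[OF that] by (auto simp: bdd_above_def)
  have h_le_w: "h (n + k) x \<le> w n x" if "x \<in> space E" for n k x
    unfolding w_def by (rule cSUP_upper[OF _ bdd_h[OF that]]) simp
  have w_le: "w n x \<le> C * V x" if "x \<in> space E" for n x
    unfolding w_def by (rule cSUP_least) (use C(2)[OF that] in auto)
  have w_nonneg: "0 \<le> w n x" if "x \<in> space E" for n x
    using h_nonneg[OF that] h_le_w[OF that] by (rule order_trans)
  have w_meas: "w n \<in> borel_measurable E" for n
    unfolding w_def[abs_def] by (intro borel_measurable_cSUP S_measurable bdd_h) auto
  have w_wbdd: "wbdd (w n)" for n
    by (rule wbdd_dominated[OF w_meas wbdd_cmult[OF wbdd_V, of C]]) (use w_nonneg w_le in auto)
  have dec: "decseq (\<lambda>n. w n x)" if x: "x \<in> space E" for x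
  proof (rule decseq_SucI)
    fix n show "w (Suc n) x \<le> w n x"
      unfolding w_def[of "Suc n"] by (rule cSUP_least) (use h_le_w[OF x, of n "Suc _"] in auto)
  qed
  have bdd_w: "bdd_below (range (\<lambda>n. w n x))" if "x \<in> space E" for x
    using w_nonneg[OF that] by (auto simp: bdd_below_def)
  have w_lim: "(\<lambda>n. w n x) \<longlonglongrightarrow> g x" if "x \<in> space E" for x
    unfolding g_def by (rule LIMSEQ_decseq_INF[OF bdd_w dec]) (use that in auto)
  have g_nonneg: "0 \<le> g x" if "x \<in> space E" for x
    by (rule LIMSEQ_le_const[OF w_lim[OF that]]) (use w_nonneg[OF that] in auto)
  have g_le: "g x \<le> C * V x" if "x \<in> space E" for x
    by (rule LIMSEQ_le_const2[OF w_lim[OF that]]) (use w_le[OF that] in auto)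
  have g_meas: "g \<in> borel_measurable E"
    unfolding g_def[abs_def] by (intro borel_measurable_cINF w_meas bdd_w) auto
  have g_wbdd: "wbdd g"
    by (rule wbdd_dominated[OF g_meas wbdd_cmult[OF wbdd_V, of C]]) (use g_nonneg g_le in auto)
  have g_K: "\<delta> \<le> g x" if "x \<in> K" for x
  proof (rule LIMSEQ_le_const[OF w_lim[OF K_space[OF that]]])
    have "\<delta> \<le> w n x" for n using \<delta>(2)[OF that, of "n + 0"] h_le_w[OF K_space[OF that], of n 0] by simp
    then show "\<exists>N. \<forall>n\<ge>N. \<delta> \<le> w n x" by blast
  qed
  have g_sub: "g x \<le> S 1 g x" if x: "x \<in> space E" for x
  proof (rule LIMSEQ_le)
    show "(\<lambda>n. w (Suc n) x) \<longlonglongrightarrow> g x" using w_lim[OF x] by (rule LIMSEQ_Suc)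
    show "(\<lambda>n. S 1 (w n) x) \<longlonglongrightarrow> S 1 g x"
      using w_nonneg w_le by (intro S_tendsto[where c=C] x w_meas g_meas w_lim) auto
    have "w (Suc n) x \<le> S 1 (w n) x" for n
      unfolding w_def[of "Suc n"]
    proof (rule cSUP_least)
      fix k
      have "h (Suc n + k) x = S 1 (h (n + k)) x" using h_Suc[OF x, of "n + k"] by simp
      also have "\<dots> \<le> S 1 (w n) x" by (intro S_mono x wbdd_S wbdd_const w_wbdd h_le_w)
      finally show "h (Suc n + k) x \<le> S 1 (w n) x" .
    qed simp
    then show "\<exists>N. \<forall>n\<ge>N. w (Suc n) x \<le> S 1 (w n) x" by blast
  qed
  define \<zeta> where "\<zeta> x = (SUP n. S n g x)" for x
  have inc: "incseq (\<lambda>n. S n g x)" if x: "x \<in> space E" for x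
  proof (rule incseq_SucI)
    fix n
    have "S n g x \<le> S n (S 1 g) x" by (intro S_mono x g_wbdd wbdd_S g_sub)
    also have "\<dots> = S (Suc n) g x" using S_S[OF x g_wbdd, of n 1] by simp
    finally show "S n g x \<le> S (Suc n) g x" .
  qed
  have S_g_le: "S n g x \<le> C * D * V x" if x: "x \<in> space E" for n x
  proof -
    have "S n g x \<le> S n (\<lambda>y. C * V y) x" by (intro S_mono x g_wbdd wbdd_cmult wbdd_V g_le)
    also have "\<dots> \<le> C * (D * V x)" unfolding S_cmult using D(2)[OF x, of n] C(1) by (intro mult_left_mono) auto
    finally show ?thesis by simp
  qed
  have S_g_nonneg: "0 \<le> S n g x" if "x \<in> space E" for n x by (rule S_nonneg[OF that g_nonneg])
  have bdd_S: "bdd_above (range (\<lambda>n. S n g x))" if "x \<in> space E" for x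
    using S_g_le[OF that] by (auto simp: bdd_above_def)
  have \<zeta>_lim: "(\<lambda>n. S n g x) \<longlonglongrightarrow> \<zeta> x" if "x \<in> space E" for x
    unfolding \<zeta>_def by (rule LIMSEQ_incseq_SUP[OF bdd_S inc]) (use that in auto)
  have g_le_\<zeta>: "g x \<le> \<zeta> x" if "x \<in> space E" for x
    unfolding \<zeta>_def using cSUP_upper[OF _ bdd_S[OF that], of 0] S_0[OF that g_wbdd] by simp
  have \<zeta>_le: "\<zeta> x \<le> C * D * V x" if "x \<in> space E" for x
    unfolding \<zeta>_def by (rule cSUP_least) (use S_g_le[OF that] in auto)
  have \<zeta>_nonneg: "0 \<le> \<zeta> x" if "x \<in> space E" for x
    using g_nonneg[OF that] g_le_\<zeta>[OF that] by linarith
  have \<zeta>_meas: "\<zeta> \<in> borel_measurable E"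
    unfolding \<zeta>_def[abs_def] by (intro borel_measurable_cSUP S_measurable g_wbdd bdd_S) auto
  have \<zeta>_wbdd: "wbdd \<zeta>"
    by (rule wbdd_dominated[OF \<zeta>_meas wbdd_cmult[OF wbdd_V, of "C * D"]]) (use \<zeta>_nonneg \<zeta>_le in auto)
  have S_\<zeta>: "S 1 \<zeta> x = \<zeta> x" if x: "x \<in> space E" for x
  proof (rule LIMSEQ_unique)
    show "(\<lambda>n. S 1 (S n g) x) \<longlonglongrightarrow> S 1 \<zeta> x"
      using S_g_le S_g_nonneg
      by (intro S_tendsto[where c="C * D"] x S_measurable g_wbdd \<zeta>_meas \<zeta>_lim) auto
    have "(\<lambda>n. S 1 (S n g) x) = (\<lambda>n. S (Suc n) g x)" using S_S[OF x g_wbdd, of 1] by simp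
    then show "(\<lambda>n. S 1 (S n g) x) \<longlonglongrightarrow> \<zeta> x" using LIMSEQ_Suc[OF \<zeta>_lim[OF x]] by simp
  qed
  define I where "I = (\<integral>x. \<zeta> x \<partial>\<mu>)"
  have "\<delta> * measure \<mu> K = (\<integral>x. \<delta> * indicator K x \<partial>\<mu>)"
    using K_sets by (simp add: sets_\<mu> space_\<mu> K_space Int_absorb2 subset_iff)
  also have "\<dots> \<le> I"
    unfolding I_def
  proof (intro \<mu>_mono wbdd_cmult wbdd_indicator K_sets \<zeta>_wbdd)
    fix x assume "x \<in> space E"
    then show "\<delta> * indicator K x \<le> \<zeta> x"
      using g_K[of x] g_le_\<zeta>[of x] \<zeta>_nonneg[of x] by (auto simp: indicator_def)
  qed
  finally have I: "0 < I" using mult_pos_pos[OF \<delta>(1) measure_\<mu>_K] by linarith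
  show ?thesis
  proof (rule exI[of _ "\<lambda>x. (1 / I) * \<zeta> x"], rule exI[of _ "C * D / I"], rule exI[of _ "\<delta> / I"],
      intro conjI ballI)
    show "wbdd (\<lambda>x. (1 / I) * \<zeta> x)" by (rule wbdd_cmult[OF \<zeta>_wbdd])
    show "0 \<le> (1 / I) * \<zeta> x" if "x \<in> space E" for x using \<zeta>_nonneg[OF that] I by simp
    show "S 1 (\<lambda>x. (1 / I) * \<zeta> x) x = (1 / I) * \<zeta> x" if "x \<in> space E" for x
      unfolding S_cmult S_\<zeta>[OF that] ..
    show "(1 / I) * \<zeta> x \<le> C * D / I * V x" if "x \<in> space E" for x
      using divide_right_mono[OF \<zeta>_le[OF that], of I] I by simp
    show "0 < \<delta> / I" using \<delta> I by simp
    show "\<delta> / I \<le> (1 / I) * \<zeta> x" if "x \<in> K" for x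
      using g_K[OF that] g_le_\<zeta>[OF K_space[OF that]] divide_right_mono[of \<delta> "\<zeta> x" I] I by simp
    show "(\<integral>x. (1 / I) * \<zeta> x \<partial>\<mu>) = 1" using I by (simp add: I_def)
  qed
qed

section \<open>Minorisation by \<open>\<nu>\<close>\<close>

lemma S_n1_lower:
  assumes x: "x \<in> K" and g: "wbdd g" "\<And>y. y \<in> space E \<Longrightarrow> 0 \<le> g y"
  shows "c1 / \<theta> ^ n1 * (\<integral>y. g y \<partial>\<nu>) \<le> S n1 g x"
proof -
  have xE: "x \<in> space E" by (rule K_space[OF x])
  have se: "sets (scale_measure (ennreal c1) \<nu>) = sets (\<kappa> n1 x)"
    by (simp add: sets_\<nu> sets_\<kappa>[OF xE])
  have le: "scale_measure (ennreal c1) \<nu> \<le> \<kappa> n1 x"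
      unfolding le_measure[OF se] le_fun_def
  proof
    fix A show "emeasure (scale_measure (ennreal c1) \<nu>) A \<le> emeasure (\<kappa> n1 x) A"
    proof (cases "A \<in> sets E")
      case True
      then show ?thesis using minorisation[OF x True] by simp
    next
      case False
      then show ?thesis by (simp add: emeasure_notin_sets sets_\<nu>)
    qed
  qed
  have "ennreal (c1 * (\<integral>y. g y \<partial>\<nu>)) = ennreal c1 * (\<integral>\<^sup>+y. ennreal (g y) \<partial>\<nu>)"
    using g c1_pos by (subst nn_integral_eq_integral[OF integrable_\<nu>]) (auto simp: space_\<nu> ennreal_mult')
  also have "\<dots> = (\<integral>\<^sup>+y. ennreal (g y) \<partial>scale_measure (ennreal c1) \<nu>)"
  proof (rule nn_integral_scale_measure[symmetric])
    show "(\<lambda>y. ennreal (g y)) \<in> borel_measurable \<nu>"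
      using wbdd_measurable[OF g(1)] by (simp add: measurable_cong_sets[OF sets_\<nu> refl])
  qed
  also have "\<dots> \<le> (\<integral>\<^sup>+y. ennreal (g y) \<partial>\<kappa> n1 x)"
    by (rule nn_integral_mono_measure[OF se le])
  also have "\<dots> = ennreal (\<integral>y. g y \<partial>\<kappa> n1 x)"
    using g by (intro nn_integral_eq_integral integrable_\<kappa> xE) (auto simp: space_\<kappa>[OF xE])
  finally have "c1 * (\<integral>y. g y \<partial>\<nu>) \<le> (\<integral>y. g y \<partial>\<kappa> n1 x)"
    using g by (subst (asm) ennreal_le_iff) (auto simp: space_\<kappa>[OF xE] intro!: integral_nonneg_AE)
  then show ?thesis using \<theta>_pos by (simp add: S_def divide_right_mono)
qed

lemma \<nu>_mono:
  assumes "wbdd f" "wbdd g" "\<And>x. x \<in> space E \<Longrightarrow> f x \<le> g x"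
  shows "(\<integral>x. f x \<partial>\<nu>) \<le> (\<integral>x. g x \<partial>\<nu>)"
  using assms by (intro integral_mono integrable_\<nu>) (auto simp: space_\<nu>)

text \<open>
  By (E4) almost every point of \<open>K\<close> lies in one of the increasing sets on which \<open>S n 1\<^sub>K > 0\<close> for all
  \<open>n \<ge> k\<close>.  Since \<open>\<nu>\<close> is carried by \<open>K\<close>, one of these sets is not null.
\<close>

lemma \<nu>_return: "\<exists>n0. \<forall>n\<ge>n0. 0 < (\<integral>x. S n (indicator K) x \<partial>\<nu>)"
proof -
  define A where "A k = {x \<in> space E. \<forall>n\<ge>k. 0 < S n (indicator K) x}" for k
  have [measurable]: "S n (indicator K) \<in> borel_measurable E" for n
    by (intro S_measurable wbdd_indicator K_sets)
  have A: "A k \<in> sets \<nu>" for k unfolding A_def sets_\<nu> by measurable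
  have "AE x in \<nu>. x \<in> (\<Union>k. A k)"
    using \<nu>_K by eventually_elim (use aperiodic K_space in \<open>force simp: A_def\<close>)
  have "\<exists>k. A k \<notin> null_sets \<nu>"
  proof (rule ccontr)
    assume "\<not> ?thesis"
    then have "(\<Union>k. A k) \<in> null_sets \<nu>" by (intro null_sets_UN) auto
    then have "AE x in \<nu>. x \<notin> (\<Union>k. A k)" by (rule AE_not_in)
    with \<open>AE x in \<nu>. x \<in> (\<Union>k. A k)\<close> have "AE x in \<nu>. False" by eventually_elim auto
    then show False using prob_space.AE_False[OF prob_\<nu>] by simp
  qed
  then obtain k where k: "A k \<notin> null_sets \<nu>" by blast
  have "0 < (\<integral>x. S n (indicator K) x \<partial>\<nu>)" if n: "n \<ge> k" for n
  proof -
    have nn: "0 \<le> S n (indicator K) x" if "x \<in> space E" for x by (rule S_nonneg[OF that]) auto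
    have i: "integrable \<nu> (S n (indicator K))" by (intro integrable_\<nu> wbdd_S wbdd_indicator K_sets)
    have "0 \<le> (\<integral>x. S n (indicator K) x \<partial>\<nu>)" using nn by (intro integral_nonneg_AE) (auto simp: space_\<nu>)
    moreover have "(\<integral>x. S n (indicator K) x \<partial>\<nu>) \<noteq> 0"
    proof
      assume "(\<integral>x. S n (indicator K) x \<partial>\<nu>) = 0"
      then have "AE x in \<nu>. S n (indicator K) x = 0"
        using nn by (subst (asm) integral_nonneg_eq_0_iff_AE[OF i]) (auto simp: space_\<nu>)
      then have "AE x in \<nu>. x \<notin> A k" by eventually_elim (use n in \<open>auto simp: A_def\<close>)
      then have "A k \<in> null_sets \<nu>" using A by (simp add: AE_iff_null_sets)
      with k show False by simp
    qed
    ultimately show ?thesis by simp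
  qed
  then show ?thesis by blast
qed

text \<open>
  An upper bound for \<open>S n V\<close> that turns into a lower bound for the occupation of \<open>K\<close> once \<open>S n V\<close>
  is known to dominate a multiple of \<open>\<eta> x\<close>.
\<close>

lemma S_V_le_occupation:
  assumes x: "x \<in> space E"
  shows "S n V x \<le> a ^ n * V x + b * (\<Sum>k<n. S k (indicator K) x)"
proof (induction n)
  case 0
  then show ?case using x by (simp add: S_0)
next
  case (Suc n)
  let ?s = "\<Sum>k<n. S k (indicator K) x"
  have s: "0 \<le> b * ?s" using x b_nonneg by (intro mult_nonneg_nonneg sum_nonneg S_nonneg) auto
  have "S (Suc n) V x \<le> a * S n V x + b * S n (indicator K) x" by (rule S_Suc_V_le[OF x])
  also have "\<dots> \<le> a * (a ^ n * V x + b * ?s) + b * S n (indicator K) x"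
    using Suc a_nonneg by (intro add_right_mono mult_left_mono)
  also have "\<dots> \<le> a ^ Suc n * V x + 1 * (b * ?s) + b * S n (indicator K) x"
    using mult_right_mono[of a 1 "b * ?s"] a_less_1 s by (simp add: algebra_simps)
  finally show ?case by (simp add: algebra_simps)
qed

end

text \<open>
  A harmonic function as produced by \<open>harmonic_function_exists\<close>.  It may vanish at some points, and
  no division by it occurs below.
\<close>

locale ground_state = quasi_stationary_semigroup +
  fixes \<eta> :: "'a \<Rightarrow> real" and C \<delta> :: real
  assumes \<eta>_wbdd: "wbdd \<eta>"
    and \<eta>_nonneg: "\<And>x. x \<in> space E \<Longrightarrow> 0 \<le> \<eta> x"
    and \<eta>_S1: "\<And>x. x \<in> space E \<Longrightarrow> S 1 \<eta> x = \<eta> x"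
    and \<eta>_le: "\<And>x. x \<in> space E \<Longrightarrow> \<eta> x \<le> C * V x"
    and \<delta>_pos: "0 < \<delta>"
    and \<eta>_K: "\<And>x. x \<in> K \<Longrightarrow> \<delta> \<le> \<eta> x"
    and \<eta>_\<mu>: "(\<integral>x. \<eta> x \<partial>\<mu>) = 1"
begin

lemma S_\<eta>: "x \<in> space E \<Longrightarrow> S n \<eta> x = \<eta> x"
proof (induction n arbitrary: x)
  case 0
  then show ?case by (simp add: S_0 \<eta>_wbdd)
next
  case (Suc n)
  have "S (Suc n) \<eta> x = S n (S 1 \<eta>) x" using S_S[OF Suc.prems \<eta>_wbdd, of n 1] by simp
  also have "\<dots> = S n \<eta> x" by (rule S_cong[OF Suc.prems \<eta>_S1])
  finally show ?case using Suc by simp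
qed

lemma S_indicator_le_\<eta>:
  assumes x: "x \<in> space E"
  shows "\<delta> * S n (indicator K) x \<le> \<eta> x"
proof -
  have "S n (\<lambda>y. \<delta> * indicator K y) x \<le> S n \<eta> x"
    using \<eta>_K \<eta>_nonneg by (intro S_mono x wbdd_cmult wbdd_indicator K_sets \<eta>_wbdd) (auto simp: indicator_def)
  then show ?thesis unfolding S_cmult S_\<eta>[OF x] .
qed

text \<open>
  Harmonicity and \<open>\<delta> 1\<^sub>K \<le> \<eta>\<close> give \<open>S n 1\<^sub>K \<le> \<eta> / \<delta>\<close> for every \<open>n\<close>.  Thus the constant \<open>B\<close> does not
  depend on \<open>n\<close>, which allows the number of steps to be chosen after it.
\<close>

lemma S_V_drift: "\<exists>B\<ge>1. \<forall>n. \<forall>x\<in>space E. S n V x \<le> a ^ n * V x + B * \<eta> x"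
proof -
  define B where "B = max 1 (b / \<delta> / (1 - a))"
  have B: "1 \<le> B" "a * B + b / \<delta> \<le> B"
  proof -
    have "b / \<delta> \<le> B * (1 - a)"
      using a_less_1 by (subst pos_divide_le_eq[symmetric]) (auto simp: B_def)
    then show "a * B + b / \<delta> \<le> B" by (simp add: algebra_simps)
  qed (simp add: B_def)
  have "S n V x \<le> a ^ n * V x + B * \<eta> x" if x: "x \<in> space E" for n x
  proof (induction n)
    case 0
    then show ?case using x B \<eta>_nonneg[OF x] by (simp add: S_0)
  next
    case (Suc n)
    have "S (Suc n) V x \<le> a * S n V x + b * S n (indicator K) x" by (rule S_Suc_V_le[OF x])
    also have "\<dots> \<le> a * (a ^ n * V x + B * \<eta> x) + b * (\<eta> x / \<delta>)"
      using Suc a_nonneg b_nonneg S_indicator_le_\<eta>[OF x, of n] \<delta>_pos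
      by (intro add_mono mult_left_mono) (auto simp: field_simps)
    also have "\<dots> = a ^ Suc n * V x + (a * B + b / \<delta>) * \<eta> x" by (simp add: algebra_simps)
    also have "\<dots> \<le> a ^ Suc n * V x + B * \<eta> x" using B(2) \<eta>_nonneg[OF x] by (intro add_left_mono mult_right_mono)
    finally show ?case .
  qed
  with B(1) show ?thesis by blast
qed

lemma C_pos: "0 < C"
proof -
  obtain x where "x \<in> K" using measure_\<mu>_K by (cases "K = {}") auto
  then have "0 < C * V x" using \<eta>_K[of x] \<eta>_le[of x] \<delta>_pos K_space[of x] by fastforce
  moreover have "0 < V x" using V_ge_1[OF K_space[OF \<open>x \<in> K\<close>]] by simp
  ultimately show ?thesis by (simp add: zero_less_mult_iff)
qed

text \<open>
  At a point with \<open>V \<le> R \<eta>\<close> the harmonic function cannot be accounted for by paths that avoid \<open>K\<close>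
  up to time \<open>J\<close>, because these contribute at most \<open>C a\<^sup>J V\<close>.  So the occupation of \<open>K\<close> before time \<open>J\<close>
  is at least a multiple of \<open>\<eta>\<close>.  From \<open>K\<close>, two applications of (E1) separated by a return from \<open>\<nu>\<close>
  to \<open>K\<close> reach \<open>\<nu>\<close>.  The length of that return is free as soon as it exceeds \<open>n0\<close>, and it is chosen
  so that the total time is \<open>N\<close> for each of the possible visiting times \<open>k < J\<close>.
\<close>

lemma minorisation_on_sublevel_sets:
  "\<exists>N\<ge>1. \<exists>k0>0. \<forall>x\<in>space E. V x \<le> R * \<eta> x \<longrightarrow>
     (\<forall>g. wbdd g \<longrightarrow> (\<forall>y\<in>space E. 0 \<le> g y) \<longrightarrow> k0 * \<eta> x * (\<integral>y. g y \<partial>\<nu>) \<le> S N g x)"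
proof -
  have "(\<lambda>j. a ^ j * (C * \<bar>R\<bar>)) \<longlonglongrightarrow> 0 * (C * \<bar>R\<bar>)"
    using a_nonneg a_less_1 by (intro tendsto_mult LIMSEQ_realpow_zero tendsto_const)
  then have "\<forall>\<^sub>F j in sequentially. a ^ j * (C * \<bar>R\<bar>) < 1 / 2"
    by (intro order_tendstoD(2)) auto
  then obtain J where J: "a ^ J * (C * \<bar>R\<bar>) < 1 / 2" "1 \<le> J"
    using eventually_conj[OF _ eventually_ge_at_top[of 1]] eventually_happens' sequentially_bot by blast
  obtain n0 where n0: "\<And>n. n \<ge> n0 \<Longrightarrow> 0 < (\<integral>x. S n (indicator K) x \<partial>\<nu>)" using \<nu>_return by blast
  \<comment> \<open>A visit to \<open>K\<close> at time \<open>k\<close> leaves \<open>n1 + (J - k + n0) + n1\<close> further steps.\<close>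
  define N where "N = J + n1 + n0 + n1"
  define p where "p = c1 / \<theta> ^ n1"
  have p: "0 < p" using c1_pos \<theta>_pos by (simp add: p_def)
  define q where "q k = p * p * (\<integral>x. S (J - k + n0) (indicator K) x \<partial>\<nu>)" for k
  have q: "0 < q k" for k unfolding q_def using p n0 by (intro mult_pos_pos) auto
  define k2 where "k2 = Min (q ` {..<J})"
  have k2: "0 < k2" "\<And>k. k < J \<Longrightarrow> k2 \<le> q k"
    using J(2) q by (auto simp: k2_def Min_gr_iff lessThan_empty_iff intro!: Min_le)
  \<comment> \<open>The summand 1 keeps \<open>Q\<close> positive even for \<open>b = 0\<close>.\<close>
  define Q where "Q = 2 * C * b * J + 1"
  have Q: "0 < Q" using C_pos b_nonneg by (auto simp: Q_def intro!: add_nonneg_pos mult_nonneg_nonneg)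
  have "k2 / Q * \<eta> x * (\<integral>y. g y \<partial>\<nu>) \<le> S N g x"
    if x: "x \<in> space E" "V x \<le> R * \<eta> x" and g: "wbdd g" "\<And>y. y \<in> space E \<Longrightarrow> 0 \<le> g y" for x g
  proof -
    let ?g = "\<integral>y. g y \<partial>\<nu>"
    have g_nonneg: "0 \<le> ?g" using g by (intro integral_nonneg_AE) (auto simp: space_\<nu>)
    have from_K: "k2 * ?g \<le> S (N - k) g y" if k: "k < J" and y: "y \<in> K" for k y
    proof -
      let ?r = "J - k + n0"
      have "q k * ?g = p * (\<integral>x. p * ?g * S ?r (indicator K) x \<partial>\<nu>)" by (simp add: q_def)
      also have "\<dots> \<le> p * (\<integral>x. S ?r (S n1 g) x \<partial>\<nu>)"
      proof (intro mult_left_mono \<nu>_mono wbdd_cmult wbdd_S wbdd_indicator K_sets g)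
        fix z assume z: "z \<in> space E"
        have "p * ?g * S ?r (indicator K) z = S ?r (\<lambda>u. p * ?g * indicator K u) z" by (simp add: S_cmult)
        also have "\<dots> \<le> S ?r (S n1 g) z"
        proof (intro S_mono z wbdd_cmult wbdd_S wbdd_indicator K_sets g)
          fix u assume u: "u \<in> space E"
          show "p * ?g * indicator K u \<le> S n1 g u"
            using S_n1_lower[of u g] g S_nonneg[OF u g(2), where n=n1] by (auto simp: indicator_def p_def)
        qed
        finally show "p * ?g * S ?r (indicator K) z \<le> S ?r (S n1 g) z" .
      qed (use p in simp)
      also have "\<dots> \<le> S n1 (S ?r (S n1 g)) y"
        unfolding p_def using g by (intro S_n1_lower y wbdd_S) (auto intro!: S_nonneg)
      also have "\<dots> = S (n1 + (?r + n1)) g y"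
        using S_S[OF K_space[OF y] g(1), of n1 "?r + n1"] S_S[OF _ g(1), of _ ?r n1]
          S_cong[OF K_space[OF y], where f="S (?r + n1) g" and g="S ?r (S n1 g)" and n=n1] by simp
      also have "n1 + (?r + n1) = N - k" using k by (simp add: N_def)
      finally show ?thesis using mult_right_mono[OF k2(2)[OF k] g_nonneg] by linarith
    qed
    have via_K: "k2 * ?g * S k (indicator K) x \<le> S N g x" if k: "k < J" for k
    proof -
      have "k2 * ?g * S k (indicator K) x = S k (\<lambda>y. k2 * ?g * indicator K y) x" by (simp add: S_cmult)
      also have "\<dots> \<le> S k (S (N - k) g) x"
        using from_K[OF k] g
        by (intro S_mono x wbdd_cmult wbdd_S wbdd_indicator K_sets) (auto simp: indicator_def intro!: S_nonneg)
      also have "\<dots> = S N g x" using S_S[OF x(1) g(1), of k "N - k"] k by (simp add: N_def)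
      finally show ?thesis .
    qed
    let ?s = "\<Sum>k<J. S k (indicator K) x"
    have "\<eta> x = S J \<eta> x" by (simp add: S_\<eta>[OF x(1)])
    also have "\<dots> \<le> S J (\<lambda>y. C * V y) x" by (intro S_mono x \<eta>_wbdd wbdd_cmult wbdd_V \<eta>_le)
    also have "\<dots> \<le> C * (a ^ J * V x + b * ?s)"
      unfolding S_cmult using S_V_le_occupation[OF x(1), of J] C_pos by (intro mult_left_mono) auto
    also have "\<dots> \<le> C * (a ^ J * (\<bar>R\<bar> * \<eta> x) + b * ?s)"
    proof (intro mult_left_mono add_right_mono)
      have "R * \<eta> x \<le> \<bar>R\<bar> * \<eta> x" using \<eta>_nonneg[OF x(1)] by (intro mult_right_mono) auto
      with x(2) show "V x \<le> \<bar>R\<bar> * \<eta> x" by linarith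
    qed (use C_pos a_nonneg in auto)
    also have "\<dots> = a ^ J * (C * \<bar>R\<bar>) * \<eta> x + C * b * ?s" by (simp add: algebra_simps)
    also have "\<dots> \<le> 1 / 2 * \<eta> x + C * b * ?s"
      using J(1) \<eta>_nonneg[OF x(1)] by (intro add_right_mono mult_right_mono) auto
    finally have "\<eta> x \<le> 2 * C * b * ?s" by simp
    then have "k2 * ?g * \<eta> x \<le> k2 * ?g * (2 * C * b * ?s)"
      using k2(1) g_nonneg by (intro mult_left_mono) auto
    also have "\<dots> = 2 * C * b * (\<Sum>k<J. k2 * ?g * S k (indicator K) x)"
      by (simp add: sum_distrib_left mult_ac)
    also have "\<dots> \<le> 2 * C * b * (\<Sum>k<J. S N g x)"
      using C_pos b_nonneg by (intro mult_left_mono sum_mono via_K) auto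
    also have "\<dots> = 2 * C * b * J * S N g x" by simp
    also have "\<dots> \<le> Q * S N g x"
      using S_nonneg[OF x(1) g(2), where n=N] by (intro mult_right_mono) (auto simp: Q_def)
    finally show ?thesis using Q by (simp add: field_simps)
  qed
  moreover have "1 \<le> N" "0 < k2 / Q" using J k2 Q by (auto simp: N_def)
  ultimately show ?thesis by blast
qed

section \<open>Geometric convergence to the harmonic function\<close>

text \<open>
  Let \<open>U = \<eta> + \<beta> V\<close> and \<open>|f| \<le> r U\<close>.  The multiple of \<open>\<eta>\<close> to be subtracted is \<open>k \<integral> f d\<nu>\<close>.  Where
  \<open>V \<le> R \<eta>\<close>, the minorisation is applied to \<open>r U - f \<ge> 0\<close> and saves \<open>k \<integral> \<eta> d\<nu>\<close> in the coefficient
  of \<open>\<eta>\<close>, which must exceed the loss \<open>\<beta> B\<close> from the drift inequality.  Where \<open>V > R \<eta>\<close>, the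
  subtracted term costs at most \<open>2 k \<integral> \<eta> d\<nu>\<close> times \<open>\<eta>\<close>, to be paid by the contraction of
  \<open>\<beta> V > \<beta> R \<eta>\<close>.  With \<open>k \<integral> \<eta> d\<nu> = 2 \<beta> B\<close> both requirements are proportional to \<open>\<beta>\<close>, so \<open>R\<close> can
  be fixed first, and \<open>\<beta>\<close> is then taken small in terms of the minorisation constant for that \<open>R\<close>.
\<close>

lemma contraction_step:
  obtains N :: nat and \<beta> \<alpha> :: real where "1 \<le> N" "0 < \<beta>" "0 < \<alpha>" "\<alpha> < 1"
    "\<forall>f r. wbdd f \<longrightarrow> (\<forall>x\<in>space E. \<bar>f x\<bar> \<le> r * (\<eta> x + \<beta> * V x)) \<longrightarrow>
      (\<exists>c. \<forall>x\<in>space E. \<bar>S N f x - c * \<eta> x\<bar> \<le> \<alpha> * r * (\<eta> x + \<beta> * V x))"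
proof -
  obtain B where B: "1 \<le> B" "\<And>n x. x \<in> space E \<Longrightarrow> S n V x \<le> a ^ n * V x + B * \<eta> x"
    using S_V_drift by blast
  \<comment> \<open>The factor 12 matches \<open>6 \<beta> B\<close>, the total to be compensated where \<open>V > R \<eta>\<close>, with the
    lower bound \<open>(1 - a) / 2\<close> for \<open>\<alpha> - a\<close>.\<close>
  define R where "R = 12 * B / (1 - a)"
  have R: "0 < R" "R * (1 - a) = 12 * B" using B a_less_1 by (auto simp: R_def)
  obtain N k0 where N: "1 \<le> N" and k0: "0 < k0"
    and minor: "\<And>x g. x \<in> space E \<Longrightarrow> V x \<le> R * \<eta> x \<Longrightarrow> wbdd g \<Longrightarrow> (\<And>y. y \<in> space E \<Longrightarrow> 0 \<le> g y) \<Longrightarrow>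
      k0 * \<eta> x * (\<integral>y. g y \<partial>\<nu>) \<le> S N g x"
    using minorisation_on_sublevel_sets[of R] by metis
  define e where "e = (\<integral>x. \<eta> x \<partial>\<nu>)"
  define W where "W = (\<integral>x. V x \<partial>\<nu>)"
  have one_\<nu>: "(\<integral>x. (c::real) \<partial>\<nu>) = c" for c
    using prob_space.emeasure_space_1[OF prob_\<nu>] by (simp add: measure_def)
  have "\<delta> = (\<integral>x. \<delta> \<partial>\<nu>)" by (simp only: one_\<nu>)
  also have "\<dots> \<le> e"
    unfolding e_def using \<nu>_K
    by (intro integral_mono_AE integrable_\<nu> wbdd_const \<eta>_wbdd) (auto elim!: eventually_mono intro: \<eta>_K)
  finally have e: "0 < e" using \<delta>_pos by simp
  have "1 = (\<integral>x. (1::real) \<partial>\<nu>)" by (simp only: one_\<nu>)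
  also have "\<dots> \<le> W" unfolding W_def by (intro \<nu>_mono wbdd_const wbdd_V V_ge_1)
  finally have W: "1 \<le> W" .
  \<comment> \<open>The first bound keeps \<open>k\<close> below the minorisation constant, the second gives \<open>\<integral> U d\<nu> \<le> 2 e\<close>.\<close>
  define \<beta> where "\<beta> = min (k0 * e / (2 * B)) (e / W)"
  have \<beta>: "0 < \<beta>" "2 * (\<beta> * B) \<le> k0 * e" "\<beta> * W \<le> e"
  proof -
    show "0 < \<beta>" using k0 e B W by (auto simp: \<beta>_def intro!: divide_pos_pos mult_pos_pos)
    have "\<beta> \<le> k0 * e / (2 * B)" "\<beta> \<le> e / W" by (auto simp: \<beta>_def)
    then show "2 * (\<beta> * B) \<le> k0 * e" "\<beta> * W \<le> e" using B W by (auto simp: field_simps)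
  qed
  define k where "k = 2 * (\<beta> * B) / e"
  have k: "0 \<le> k" "k \<le> k0" "k * e = 2 * (\<beta> * B)"
    using \<beta> B e by (auto simp: k_def field_simps)
  \<comment> \<open>The first entry is the coefficient of \<open>\<eta>\<close> where \<open>V \<le> R \<eta>\<close>; the second keeps \<open>\<alpha>\<close> away from \<open>a\<close>.\<close>
  define \<alpha> where "\<alpha> = max (1 - \<beta> * B) ((1 + a) / 2)"
  have \<beta>B: "0 < \<beta> * B" using \<beta> B by simp
  have \<alpha>: "0 < \<alpha>" "\<alpha> < 1" "1 - \<beta> * B \<le> \<alpha>" "(1 + a) / 2 \<le> \<alpha>" "a \<le> \<alpha>"
    using a_nonneg a_less_1 \<beta>B by (auto simp: \<alpha>_def less_max_iff_disj le_max_iff_disj)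
  define U where "U x = \<eta> x + \<beta> * V x" for x
  have U_wbdd: "wbdd U" unfolding U_def[abs_def] by (intro wbdd_add wbdd_cmult \<eta>_wbdd wbdd_V)
  have U_nonneg: "0 \<le> U x" if "x \<in> space E" for x
    using \<eta>_nonneg[OF that] V_ge_1[OF that] \<beta> by (auto simp: U_def)
  have \<nu>_U: "(\<integral>x. U x \<partial>\<nu>) = e + \<beta> * W"
    unfolding U_def[abs_def] e_def W_def
    by (subst Bochner_Integration.integral_add) (auto intro!: integrable_\<nu> \<eta>_wbdd wbdd_cmult)
  have "a ^ N \<le> a" using N a_nonneg a_less_1 power_decreasing[of 1 N a] by simp
  have S_U: "S N U x \<le> (1 + \<beta> * B) * \<eta> x + a * \<beta> * V x" if x: "x \<in> space E" for x
  proof -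
    have "S N U x = \<eta> x + \<beta> * S N V x"
      unfolding U_def[abs_def] using x
      by (subst S_add) (auto simp: S_\<eta> S_cmult intro!: \<eta>_wbdd wbdd_cmult)
    also have "S N V x \<le> a ^ N * V x + B * \<eta> x" by (rule B(2)[OF x])
    also have "a ^ N * V x \<le> a * V x"
      using \<open>a ^ N \<le> a\<close> V_ge_1[OF x] by (intro mult_right_mono) auto
    finally show ?thesis using \<beta>(1) by (simp add: algebra_simps)
  qed
  have bound: "S N f x - k * (\<integral>y. f y \<partial>\<nu>) * \<eta> x \<le> \<alpha> * r * U x"
    if f: "wbdd f" and r: "\<And>x. x \<in> space E \<Longrightarrow> \<bar>f x\<bar> \<le> r * U x" and r0: "0 \<le> r" and x: "x \<in> space E" for f r x
  proof -
    let ?f = "\<integral>y. f y \<partial>\<nu>"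
    have rU: "wbdd (\<lambda>y. r * U y)" by (rule wbdd_cmult[OF U_wbdd])
    have \<eta>x: "0 \<le> \<eta> x" and Vx: "1 \<le> V x" using \<eta>_nonneg V_ge_1 x by auto
    have "S N f x - k * ?f * \<eta> x \<le> r * (\<alpha> * \<eta> x + \<alpha> * \<beta> * V x)"
    proof (cases "V x \<le> R * \<eta> x")
      case True
      have "k * \<eta> x * (\<integral>y. r * U y - f y \<partial>\<nu>) \<le> k0 * \<eta> x * (\<integral>y. r * U y - f y \<partial>\<nu>)"
        using r k \<eta>x by (intro mult_right_mono integral_nonneg_AE) (auto simp: space_\<nu> abs_le_iff)
      also have "\<dots> \<le> S N (\<lambda>y. r * U y - f y) x"
        using r by (intro minor x True wbdd_diff rU f) (auto simp: abs_le_iff)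
      also have "\<dots> = r * S N U x - S N f x"
        using f rU x U_wbdd by (subst S_diff) (auto simp: S_cmult)
      also have "(\<integral>y. r * U y - f y \<partial>\<nu>) = r * (e + \<beta> * W) - ?f"
        using f rU U_wbdd by (subst Bochner_Integration.integral_diff) (auto intro!: integrable_\<nu> simp: \<nu>_U)
      finally have "S N f x - k * ?f * \<eta> x \<le> r * S N U x - k * \<eta> x * (r * (e + \<beta> * W))"
        by (simp add: algebra_simps)
      also have "\<dots> = r * (S N U x - (k * e) * \<eta> x - k * \<eta> x * (\<beta> * W))" by (simp add: algebra_simps)
      also have "\<dots> \<le> r * (\<alpha> * \<eta> x + \<alpha> * \<beta> * V x)"
      proof (rule mult_left_mono[OF _ r0])
        have "0 \<le> k * \<eta> x * (\<beta> * W)" using k \<eta>x \<beta> W by (intro mult_nonneg_nonneg) auto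
        moreover have "(1 - \<beta> * B) * \<eta> x \<le> \<alpha> * \<eta> x" using \<alpha> \<eta>x by (intro mult_right_mono)
        moreover have "a * (\<beta> * V x) \<le> \<alpha> * (\<beta> * V x)" using \<alpha> \<beta> Vx by (intro mult_right_mono) auto
        ultimately show "S N U x - (k * e) * \<eta> x - k * \<eta> x * (\<beta> * W) \<le> \<alpha> * \<eta> x + \<alpha> * \<beta> * V x"
          using S_U[OF x] unfolding k(3) by (simp add: algebra_simps)
      qed
      finally show ?thesis .
    next
      case False
      have "S N f x \<le> S N (\<lambda>y. r * U y) x" using r by (intro S_mono x f rU) (auto simp: abs_le_iff)
      then have 1: "S N f x \<le> r * S N U x" unfolding S_cmult .
      have "- ?f \<le> r * (e + \<beta> * W)"
      proof -
        have "(\<integral>y. - 1 * f y \<partial>\<nu>) \<le> (\<integral>y. r * U y \<partial>\<nu>)"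
          using r by (intro \<nu>_mono rU wbdd_cmult f) (auto simp: abs_le_iff)
        then show ?thesis by (simp add: \<nu>_U)
      qed
      also have "r * (e + \<beta> * W) \<le> r * (2 * e)" using \<beta> r0 by (intro mult_left_mono) auto
      finally have "k * \<eta> x * (- ?f) \<le> k * \<eta> x * (r * (2 * e))"
        using k \<eta>x by (intro mult_left_mono) auto
      also have "\<dots> = r * (2 * (k * e) * \<eta> x)" by simp
      also have "\<dots> = r * (4 * (\<beta> * B) * \<eta> x)" unfolding k(3) by simp
      finally have "S N f x - k * ?f * \<eta> x \<le> r * (S N U x + 4 * (\<beta> * B) * \<eta> x)"
        using 1 by (simp add: algebra_simps)
      also have "\<dots> \<le> r * (\<alpha> * \<eta> x + \<alpha> * \<beta> * V x)"
      proof (rule mult_left_mono[OF _ r0])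
        have "(1 - \<alpha> + 5 * (\<beta> * B)) * \<eta> x \<le> (6 * (\<beta> * B)) * \<eta> x" using \<alpha>(3) \<eta>x by (intro mult_right_mono) linarith+
        also have "\<dots> = \<beta> * (R * (1 - a) / 2) * \<eta> x" unfolding R(2) by simp
        also have "\<dots> = \<beta> * ((1 - a) / 2) * (R * \<eta> x)" by simp
        also have "\<dots> \<le> \<beta> * (\<alpha> - a) * V x"
          using False \<beta> \<alpha> a_less_1 R \<eta>x by (intro mult_mono mult_nonneg_nonneg) (auto simp: field_simps)
        finally show "S N U x + 4 * (\<beta> * B) * \<eta> x \<le> \<alpha> * \<eta> x + \<alpha> * \<beta> * V x"
          using S_U[OF x] by (simp add: algebra_simps)
      qed
      finally show ?thesis .
    qed
    also have "\<dots> = \<alpha> * r * U x" by (simp add: U_def algebra_simps)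
    finally show ?thesis .
  qed
  have step: "\<forall>f r. wbdd f \<longrightarrow> (\<forall>x\<in>space E. \<bar>f x\<bar> \<le> r * (\<eta> x + \<beta> * V x)) \<longrightarrow>
      (\<exists>c. \<forall>x\<in>space E. \<bar>S N f x - c * \<eta> x\<bar> \<le> \<alpha> * r * (\<eta> x + \<beta> * V x))"
  proof (intro allI impI)
    fix f r assume f: "wbdd f" and r: "\<forall>x\<in>space E. \<bar>f x\<bar> \<le> r * (\<eta> x + \<beta> * V x)"
    show "\<exists>c. \<forall>x\<in>space E. \<bar>S N f x - c * \<eta> x\<bar> \<le> \<alpha> * r * (\<eta> x + \<beta> * V x)"
    proof (intro exI[of _ "k * (\<integral>y. f y \<partial>\<nu>)"] ballI)
      fix x assume x: "x \<in> space E"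
      have r': "\<bar>f y\<bar> \<le> r * U y" if "y \<in> space E" for y using r that by (simp add: U_def)
      have "0 < U x" using \<eta>_nonneg[OF x] V_ge_1[OF x] \<beta> by (auto simp: U_def intro!: add_nonneg_pos)
      then have r0: "0 \<le> r" using r'[OF x] by (meson abs_ge_zero order_trans zero_le_mult_iff not_le)
      have "S N f x - k * (\<integral>y. f y \<partial>\<nu>) * \<eta> x \<le> \<alpha> * r * U x" by (rule bound[OF f r' r0 x])
      moreover have "S N (\<lambda>y. - 1 * f y) x - k * (\<integral>y. - 1 * f y \<partial>\<nu>) * \<eta> x \<le> \<alpha> * r * U x"
        using r' by (intro bound r0 x wbdd_cmult f) auto
      ultimately show "\<bar>S N f x - k * (\<integral>y. f y \<partial>\<nu>) * \<eta> x\<bar> \<le> \<alpha> * r * (\<eta> x + \<beta> * V x)"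
        unfolding S_cmult U_def by (simp add: abs_le_iff)
    qed
  qed
  show thesis by (rule that[OF N \<beta>(1) \<alpha>(1,2) step])
qed

text \<open>
  Iterating the contraction bounds the distance of \<open>h (j N) - \<eta>\<close> to the line spanned by \<open>\<eta>\<close>.  Both
  \<open>h (j N)\<close> and \<open>\<eta>\<close> have integral one under \<open>\<mu>\<close>, so the coefficient on that line is as small as the
  distance itself.
\<close>

lemma h_converges_along_multiples:
  obtains N :: nat and \<alpha> A :: real where "1 \<le> N" "0 < \<alpha>" "\<alpha> < 1"
    "\<forall>j. \<forall>x\<in>space E. \<bar>h (j * N) x - \<eta> x\<bar> \<le> A * \<alpha> ^ j * V x"
proof -
  obtain N \<beta> \<alpha> where N: "1 \<le> N" and \<beta>: "0 < \<beta>" and \<alpha>: "0 < \<alpha>" "\<alpha> < 1"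
    and step: "\<forall>f r. wbdd f \<longrightarrow> (\<forall>x\<in>space E. \<bar>f x\<bar> \<le> r * (\<eta> x + \<beta> * V x)) \<longrightarrow>
      (\<exists>c. \<forall>x\<in>space E. \<bar>S N f x - c * \<eta> x\<bar> \<le> \<alpha> * r * (\<eta> x + \<beta> * V x))"
    by (rule contraction_step)
  \<comment> \<open>Chosen such that \<open>|1 - \<eta>| \<le> (1 + C) V \<le> r (\<eta> + \<beta> V)\<close>.\<close>
  define r where "r = (1 + C) / \<beta>"
  have r: "0 < r" using C_pos \<beta> by (simp add: r_def)
  define U where "U x = \<eta> x + \<beta> * V x" for x
  have U_wbdd: "wbdd U" unfolding U_def[abs_def] by (intro wbdd_add wbdd_cmult \<eta>_wbdd wbdd_V)
  have mod_\<eta>: "\<exists>c. \<forall>x\<in>space E. \<bar>h (j * N) x - \<eta> x - c * \<eta> x\<bar> \<le> \<alpha> ^ j * r * U x" for j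
  proof (induction j)
    case 0
    show ?case
    proof (intro exI[of _ 0] ballI)
      fix x assume x: "x \<in> space E"
      have "\<bar>h 0 x - \<eta> x\<bar> \<le> 1 + \<eta> x" using \<eta>_nonneg[OF x] by (simp add: S_0[OF x])
      also have "\<dots> \<le> (1 + C) * V x" using \<eta>_le[OF x] V_ge_1[OF x] by (simp add: algebra_simps)
      also have "\<dots> = r * (\<beta> * V x)" using \<beta> by (simp add: r_def)
      also have "\<dots> \<le> r * U x" using r \<eta>_nonneg[OF x] by (intro mult_left_mono) (auto simp: U_def)
      finally show "\<bar>h (0 * N) x - \<eta> x - 0 * \<eta> x\<bar> \<le> \<alpha> ^ 0 * r * U x" by simp
    qed
  next
    case (Suc j)
    then obtain c where c: "\<And>x. x \<in> space E \<Longrightarrow> \<bar>h (j * N) x - \<eta> x - c * \<eta> x\<bar> \<le> \<alpha> ^ j * r * U x" by blast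
    define f where "f x = h (j * N) x - \<eta> x - c * \<eta> x" for x
    have f: "wbdd f" unfolding f_def[abs_def] by (intro wbdd_diff wbdd_S wbdd_const wbdd_cmult \<eta>_wbdd)
    obtain d where d: "\<And>x. x \<in> space E \<Longrightarrow> \<bar>S N f x - d * \<eta> x\<bar> \<le> \<alpha> * (\<alpha> ^ j * r) * (\<eta> x + \<beta> * V x)"
      using step[rule_format, OF f, of "\<alpha> ^ j * r"] c unfolding f_def U_def by blast
    show ?case
    proof (intro exI[of _ "c + d"] ballI)
      fix x assume x: "x \<in> space E"
      have "S N f x = S N (h (j * N)) x - \<eta> x - c * \<eta> x"
        unfolding f_def[abs_def]
        using x by (simp add: S_diff S_cmult S_\<eta> \<eta>_wbdd wbdd_diff wbdd_cmult wbdd_S)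
      moreover have "S N (h (j * N)) x = h (Suc j * N) x" using h_add[OF x, of N "j * N"] by simp
      ultimately show "\<bar>h (Suc j * N) x - \<eta> x - (c + d) * \<eta> x\<bar> \<le> \<alpha> ^ Suc j * r * U x"
        using d[OF x] by (simp add: U_def algebra_simps)
    qed
  qed
  define W where "W = (\<integral>x. U x \<partial>\<mu>)"
  have "\<bar>h (j * N) x - \<eta> x\<bar> \<le> r * (C + \<beta> + W * C) * \<alpha> ^ j * V x" if x: "x \<in> space E" for j x
  proof -
    obtain c where c: "\<And>x. x \<in> space E \<Longrightarrow> \<bar>h (j * N) x - \<eta> x - c * \<eta> x\<bar> \<le> \<alpha> ^ j * r * U x"
      using mod_\<eta> by blast
    let ?f = "\<lambda>x. h (j * N) x - \<eta> x - c * \<eta> x"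
    have f: "wbdd ?f" by (intro wbdd_diff wbdd_S wbdd_const wbdd_cmult \<eta>_wbdd)
    have "(\<integral>x. ?f x \<partial>\<mu>) = - c"
      by (subst Bochner_Integration.integral_diff Bochner_Integration.integral_diff,
          intro integrable_\<mu> wbdd_diff wbdd_S wbdd_const wbdd_cmult \<eta>_wbdd,
          intro integrable_\<mu> wbdd_diff wbdd_S wbdd_const wbdd_cmult \<eta>_wbdd)+
        (simp add: \<mu>_h \<eta>_\<mu>)
    moreover have "\<bar>\<integral>x. ?f x \<partial>\<mu>\<bar> \<le> (\<integral>x. \<bar>?f x\<bar> \<partial>\<mu>)" by (rule integral_abs_bound)
    moreover have "(\<integral>x. \<bar>?f x\<bar> \<partial>\<mu>) \<le> (\<integral>x. \<alpha> ^ j * r * U x \<partial>\<mu>)"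
      using c by (intro integral_mono integrable_abs integrable_\<mu> f wbdd_cmult U_wbdd) (auto simp: space_\<mu>)
    ultimately have c_le: "\<bar>c\<bar> \<le> \<alpha> ^ j * r * W" by (simp add: W_def)
    have "\<bar>h (j * N) x - \<eta> x\<bar> \<le> \<alpha> ^ j * r * U x + \<bar>c\<bar> * \<eta> x"
      using c[OF x] abs_mult[of c "\<eta> x"] \<eta>_nonneg[OF x] by simp
    also have "\<dots> \<le> \<alpha> ^ j * r * ((C + \<beta>) * V x) + \<alpha> ^ j * r * W * (C * V x)"
    proof (intro add_mono mult_left_mono mult_mono c_le \<eta>_le x \<eta>_nonneg)
      show "U x \<le> (C + \<beta>) * V x" using \<eta>_le[OF x] by (simp add: U_def algebra_simps)
      show "0 \<le> \<alpha> ^ j * r" using r \<alpha> by simp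
      show "0 \<le> \<alpha> ^ j * r * W" using c_le by linarith
    qed
    also have "\<dots> = (r * (C + \<beta> + W * C)) * \<alpha> ^ j * V x" by (simp add: algebra_simps)
    finally show ?thesis .
  qed
  then have "\<forall>j. \<forall>x\<in>space E. \<bar>h (j * N) x - \<eta> x\<bar> \<le> r * (C + \<beta> + W * C) * \<alpha> ^ j * V x"
    by (intro allI ballI)
  then show thesis by (rule that[OF N \<alpha>])
qed

text \<open>
  The remaining \<open>n mod N\<close> steps cost a bounded factor, since \<open>S i V\<close> is bounded by a multiple of \<open>V\<close>
  uniformly in \<open>i\<close>.
\<close>

lemma h_converges_geometrically:
  obtains A \<alpha> :: real where "0 < A" "0 < \<alpha>" "\<alpha> < 1"
    "\<forall>n. \<forall>x\<in>space E. \<bar>h n x - \<eta> x\<bar> \<le> A * \<alpha> ^ n * V x"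
proof -
  obtain N \<alpha> A where N: "1 \<le> N" and \<alpha>: "0 < \<alpha>" "\<alpha> < 1"
    and conv: "\<forall>j. \<forall>x\<in>space E. \<bar>h (j * N) x - \<eta> x\<bar> \<le> A * \<alpha> ^ j * V x"
    by (rule h_converges_along_multiples)
  obtain D where D: "1 \<le> D" "\<And>n x. x \<in> space E \<Longrightarrow> S n V x \<le> D * V x" using S_V_bounded by blast
  define \<rho> where "\<rho> = \<alpha> powr (1 / N)"
  have \<rho>: "0 < \<rho>" "\<rho> < 1"
    using \<alpha> N powr_less_mono2[of "1 / N" \<alpha> 1] by (auto simp: \<rho>_def)
  have \<rho>N: "\<rho> ^ N = \<alpha>" using \<alpha> N by (simp add: \<rho>_def powr_realpow[symmetric] powr_powr)
  have bd: "\<bar>h n x - \<eta> x\<bar> \<le> max 1 A * D / \<rho> ^ N * \<rho> ^ n * V x" if x: "x \<in> space E" for n x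
  proof -
    define j i where "j = n div N" and "i = n mod N"
    have n: "n = i + j * N" by (simp add: i_def j_def)
    have i: "i \<le> N" using N by (simp add: i_def less_imp_le)
    have u: "wbdd (\<lambda>y. h (j * N) y - \<eta> y)" by (intro wbdd_diff wbdd_S wbdd_const \<eta>_wbdd)
    have "h n x - \<eta> x = S i (\<lambda>y. h (j * N) y - \<eta> y) x"
      using h_add[OF x, of i "j * N"] x
      by (subst S_diff) (auto simp: n S_\<eta> intro!: wbdd_S \<eta>_wbdd)
    also have "\<bar>\<dots>\<bar> \<le> S i (\<lambda>y. max 1 A * \<alpha> ^ j * V y) x"
    proof (intro S_abs_le x u wbdd_cmult wbdd_V)
      fix y assume y: "y \<in> space E"
      have "A * (\<alpha> ^ j * V y) \<le> max 1 A * (\<alpha> ^ j * V y)"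
        using \<alpha> V_ge_1[OF y] by (intro mult_right_mono) auto
      then show "\<bar>h (j * N) y - \<eta> y\<bar> \<le> max 1 A * \<alpha> ^ j * V y" using conv[rule_format, OF y, of j] by (simp add: mult.assoc)
    qed
    also have "\<dots> \<le> max 1 A * \<alpha> ^ j * (D * V x)"
      unfolding S_cmult using D(2)[OF x] \<alpha> by (intro mult_left_mono) auto
    also have "\<dots> = max 1 A * D * V x * (\<alpha> ^ j * 1)" by simp
    also have "\<dots> \<le> max 1 A * D * V x * (\<alpha> ^ j * (\<rho> ^ i / \<rho> ^ N))"
    proof (intro mult_left_mono)
      have "\<rho> ^ N \<le> \<rho> ^ i" using \<rho> i by (intro power_decreasing) auto
      then show "1 \<le> \<rho> ^ i / \<rho> ^ N" using \<rho> by simp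
    qed (use \<alpha> D V_ge_1[OF x] in auto)
    also have "\<alpha> ^ j * (\<rho> ^ i / \<rho> ^ N) = \<rho> ^ n / \<rho> ^ N"
      unfolding n power_add mult.commute[of j N] power_mult \<rho>N by simp
    also have "max 1 A * D * V x * (\<rho> ^ n / \<rho> ^ N) = max 1 A * D / \<rho> ^ N * \<rho> ^ n * V x" by simp
    finally show ?thesis .
  qed
  have pos: "0 < max 1 A * D / \<rho> ^ N" using D \<rho> by (intro divide_pos_pos mult_pos_pos) auto
  have "\<forall>n. \<forall>x\<in>space E. \<bar>h n x - \<eta> x\<bar> \<le> max 1 A * D / \<rho> ^ N * \<rho> ^ n * V x"
    by (intro allI ballI bd)
  then show thesis by (rule that[OF pos \<rho>])
qed

end

section \<open>The transition semigroup of an absorbed Markov process\<close>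

locale absorbed_chain =
  fixes X :: "('a, 'w) absorbed_process"
  assumes markov: "absorbed_markov_process X"
begin

abbreviation "E \<equiv> live X"
abbreviation "SS \<equiv> state_space X"

text \<open>
  The law of \<open>X\<^sub>n\<close> on the event of survival.  The restriction to \<open>E\<close> removes the mass at the cemetery.
\<close>

definition kern :: "nat \<Rightarrow> 'a \<Rightarrow> 'a measure" where
  "kern n x = restrict_space (distr (law X x) SS (proc X (real n))) (space E)"

lemma space_SS: "space SS = insert (cemetery X) (space E)"
  unfolding state_space_def using sets.sets_into_space by (subst space_measure_of) blast+

lemma sets_SS: "sets SS = sigma_sets (insert (cemetery X) (space E)) (insert {cemetery X} (sets E))"
  unfolding state_space_def using sets.sets_into_space by (subst sets_measure_of) blast+

lemma live_in_SS: "A \<in> sets E \<Longrightarrow> A \<in> sets SS"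
  unfolding sets_SS by (rule sigma_sets.Basic) simp

lemma cemetery_in_SS: "{cemetery X} \<in> sets SS"
  unfolding sets_SS by (rule sigma_sets.Basic) simp

lemma cemetery_notin: "cemetery X \<notin> space E"
  using markov by (simp add: absorbed_markov_process_def)

lemma id_measurable: "(\<lambda>x. x) \<in> measurable E SS"
  unfolding state_space_def
proof (rule measurable_measure_of)
  fix A assume "A \<in> insert {cemetery X} (sets E)"
  then show "(\<lambda>x. x) -` A \<inter> space E \<in> sets E"
    using cemetery_notin by (auto simp: Int_absorb2 sets.sets_into_space)
qed (use sets.sets_into_space in blast)+

lemma trace_SS: "B \<in> sets SS \<Longrightarrow> B \<inter> space E \<in> sets E"
  using measurable_sets[OF id_measurable] by simp

text \<open>
  The \<open>\<sigma>\<close>-algebra of the state space induces the given one on \<open>E\<close>; the inclusion of \<open>E\<close> being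
  measurable is what excludes further sets.
\<close>

lemma sets_trace: "sets (restrict_space SS (space E)) = sets E"
proof
  show "sets (restrict_space SS (space E)) \<subseteq> sets E"
    using trace_SS by (auto simp: sets_restrict_space Int_commute)
  show "sets E \<subseteq> sets (restrict_space SS (space E))"
  proof
    fix A assume A: "A \<in> sets E"
    then have "A = space E \<inter> A" by (simp add: Int_absorb1 sets.sets_into_space)
    with live_in_SS[OF A] show "A \<in> sets (restrict_space SS (space E))"
      unfolding sets_restrict_space by (rule image_eqI[rotated])
  qed
qed

lemma real_in_time_set: "real n \<in> time_set X"
proof -
  have "real n \<in> range (\<lambda>j::nat. real j / real k)" if "k \<ge> 1" for k :: nat
    using that by (intro image_eqI[of _ _ "n * k"]) auto
  with markov show ?thesis by (auto simp: absorbed_markov_process_def)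
qed

lemma proc_measurable [measurable]: "proc X (real n) \<in> measurable (sample X) SS"
  using markov real_in_time_set by (simp add: absorbed_markov_process_def)

lemma live_imp_state: "x \<in> space E \<Longrightarrow> x \<in> space SS"
  by (simp add: space_SS)

lemma prob_law: "x \<in> space SS \<Longrightarrow> prob_space (law X x)"
  using markov by (simp add: absorbed_markov_process_def)

lemma sets_law: "x \<in> space SS \<Longrightarrow> sets (law X x) = sets (sample X)"
  using markov by (simp add: absorbed_markov_process_def)

lemma space_law: "x \<in> space SS \<Longrightarrow> space (law X x) = space (sample X)"
  by (rule sets_eq_imp_space_eq[OF sets_law])

lemma proc_measurable_law: "x \<in> space SS \<Longrightarrow> proc X (real n) \<in> measurable (law X x) SS"
  using proc_measurable by (simp add: measurable_cong_sets[OF sets_law refl])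

lemma in_at_sets: "B \<in> sets SS \<Longrightarrow> in_at X n B \<in> sets (sample X)"
  using measurable_sets[OF proc_measurable] by (simp add: in_at_def vimage_def Int_def conj_commute)

lemma sets_kern: "x \<in> space E \<Longrightarrow> sets (kern n x) = sets E"
  using sets_trace by (simp add: kern_def sets_restrict_space)

lemma space_kern: "x \<in> space E \<Longrightarrow> space (kern n x) = space E"
  by (rule sets_eq_imp_space_eq[OF sets_kern])

lemma emeasure_kern:
  assumes "x \<in> space E" "A \<in> sets E"
  shows "emeasure (kern n x) A = emeasure (law X x) (in_at X n A)"
proof -
  have x: "x \<in> space SS" by (rule live_imp_state[OF assms(1)])
  have "emeasure (kern n x) A = emeasure (distr (law X x) SS (proc X (real n))) A"
    unfolding kern_def using assms live_in_SS[OF sets.top] live_in_SS[OF assms(2)] sets.sets_into_space[OF live_in_SS[OF sets.top]]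
    by (intro emeasure_restrict_space) (auto simp: Int_absorb2 sets.sets_into_space)
  also have "\<dots> = emeasure (law X x) (in_at X n A)"
    using live_in_SS[OF assms(2)] by (subst emeasure_distr[OF proc_measurable_law[OF x]])
      (auto simp: in_at_def space_law[OF x] vimage_def intro!: arg_cong[where f="emeasure _"])
  finally show ?thesis .
qed

lemma measure_kern:
  "x \<in> space E \<Longrightarrow> A \<in> sets E \<Longrightarrow> measure (kern n x) A = measure (law X x) (in_at X n A)"
  by (simp add: measure_def emeasure_kern)

lemma subprob_kern: "x \<in> space E \<Longrightarrow> subprob_space (kern n x)"
proof (rule subprob_spaceI)
  assume x: "x \<in> space E"
  show "emeasure (kern n x) (space (kern n x)) \<le> 1"
    unfolding space_kern[OF x] emeasure_kern[OF x sets.top]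
    using prob_space.emeasure_le_1[OF prob_law[OF live_imp_state[OF x]]] .
  show "space (kern n x) \<noteq> {}" using x space_kern[OF x] by auto
qed

lemma measure_law_measurable:
  "B \<in> sets SS \<Longrightarrow> (\<lambda>x. measure (law X x) (in_at X n B)) \<in> borel_measurable SS"
  using markov real_in_time_set by (simp add: absorbed_markov_process_def in_at_def)

lemma kern_measurable: "kern n \<in> measurable E (subprob_algebra E)"
proof (rule measurable_subprob_algebra)
  fix A assume A: "A \<in> sets E"
  have "(\<lambda>x. ennreal (measure (law X x) (in_at X n A))) \<in> borel_measurable E"
    using measurable_compose[OF id_measurable measure_law_measurable[OF live_in_SS[OF A]]] by simp
  moreover have "emeasure (kern n x) A = ennreal (measure (law X x) (in_at X n A))" if "x \<in> space E" for x
    using that A prob_law[OF live_imp_state[OF that]]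
    by (simp add: emeasure_kern finite_measure.emeasure_eq_measure prob_space_def)
  ultimately show "(\<lambda>x. emeasure (kern n x) A) \<in> borel_measurable E"
    by (simp cong: measurable_cong)
qed (auto simp: subprob_kern sets_kern)

lemma distr_0: "x \<in> space SS \<Longrightarrow> distr (law X x) SS (proc X 0) = return SS x"
  using markov by (simp add: absorbed_markov_process_def)

lemma emeasure_in_at_0:
  assumes "x \<in> space SS" "B \<in> sets SS"
  shows "emeasure (law X x) (in_at X 0 B) = indicator B x"
proof -
  have "emeasure (distr (law X x) SS (proc X (real 0))) B = indicator B x"
    using distr_0[OF assms(1)] assms by simp
  moreover have "emeasure (distr (law X x) SS (proc X (real 0))) B = emeasure (law X x) (in_at X 0 B)"
    using assms by (subst emeasure_distr[OF proc_measurable_law[OF assms(1)]])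
      (auto simp: in_at_def space_law vimage_def intro!: arg_cong[where f="emeasure _"])
  ultimately show ?thesis by simp
qed

lemma kern_0:
  assumes x: "x \<in> space E" shows "kern 0 x = return E x"
proof (rule measure_eqI)
  fix A assume "A \<in> sets (kern 0 x)"
  then have A: "A \<in> sets E" by (simp add: sets_kern[OF x])
  show "emeasure (kern 0 x) A = emeasure (return E x) A"
    using A by (simp add: emeasure_kern[OF x A] emeasure_in_at_0 live_imp_state[OF x] live_in_SS)
qed (simp add: sets_kern[OF x])

lemma AE_absorbed:
  assumes "x \<in> space SS"
  shows "AE \<omega> in law X x. absorption_time X \<omega> \<le> ereal (real n) \<longrightarrow> proc X (real n) \<omega> = cemetery X"
proof -
  have "AE \<omega> in law X x. \<forall>t\<in>time_set X. absorption_time X \<omega> \<le> ereal t \<longrightarrow> proc X t \<omega> = cemetery X"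
    using markov assms by (simp add: absorbed_markov_process_def)
  then show ?thesis by eventually_elim (use real_in_time_set in blast)
qed

lemma absorption_time_le: "proc X (real n) \<omega> = cemetery X \<Longrightarrow> absorption_time X \<omega> \<le> ereal (real n)"
  unfolding absorption_time_def using real_in_time_set by (intro Inf_lower) auto

text \<open>
  If \<open>X\<^sub>n\<close> is the cemetery then the absorption time is at most \<open>n\<close> by definition; the converse is
  almost sure absorption.
\<close>

lemma AE_alive_iff:
  assumes x: "x \<in> space SS"
  shows "AE \<omega> in law X x. \<omega> \<in> alive X n \<longleftrightarrow> proc X (real n) \<omega> \<in> space E"
proof -
  have "AE \<omega> in law X x. \<omega> \<in> space (sample X)" using AE_space[of "law X x"] by (simp add: space_law[OF x])
  with AE_absorbed[OF x, of n] show ?thesis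
  proof eventually_elim
    case (elim \<omega>)
    have "proc X (real n) \<omega> \<in> space SS" using measurable_space[OF proc_measurable elim(2)] .
    then show ?case
      using elim absorption_time_le[of n \<omega>] cemetery_notin by (auto simp: alive_def space_SS not_less)
  qed
qed

text \<open>
  The event of survival is measurable only for the completion, where it is replaced by \<open>X\<^sub>n \<in> E\<close>.
\<close>

lemma pr_from_alive_in:
  assumes x: "x \<in> space E" and A: "A \<in> sets E"
  shows "pr_from X x (in_at X n A \<inter> alive X n) = measure (kern n x) A"
proof -
  have xS: "x \<in> space SS" by (rule live_imp_state[OF x])
  have B: "in_at X n A \<in> sets (completion (law X x))"
    using in_at_sets[OF live_in_SS[OF A]] by (intro sets_completionI_sets) (simp add: sets_law[OF xS])
  have ae: "AE \<omega> in completion (law X x). \<omega> \<in> in_at X n A \<longleftrightarrow> \<omega> \<in> in_at X n A \<inter> alive X n"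
    using AE_completion[OF AE_alive_iff[OF xS, of n]]
    by eventually_elim (use sets.sets_into_space[OF A] in \<open>auto simp: in_at_def\<close>)
  have "in_at X n A \<inter> alive X n \<in> sets (completion (law X x))"
    by (rule completion.in_sets_AE[OF ae B]) (auto simp: in_at_def space_law[OF xS])
  then have "measure (completion (law X x)) (in_at X n A \<inter> alive X n) = measure (completion (law X x)) (in_at X n A)"
    using ae B by (intro measure_eq_AE) auto
  then show ?thesis
    unfolding pr_from_def measure_kern[OF x A]
    using in_at_sets[OF live_in_SS[OF A]] by (simp add: sets_law[OF xS])
qed

lemma pr_from_alive:
  assumes x: "x \<in> space E"
  shows "pr_from X x (alive X n) = measure (kern n x) (space E)"
proof -
  have xS: "x \<in> space SS" by (rule live_imp_state[OF x])
  have B: "in_at X n (space E) \<in> sets (completion (law X x))"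
    using in_at_sets[OF live_in_SS[OF sets.top]] by (intro sets_completionI_sets) (simp add: sets_law[OF xS])
  have ae: "AE \<omega> in completion (law X x). \<omega> \<in> in_at X n (space E) \<longleftrightarrow> \<omega> \<in> alive X n"
    using AE_completion[OF AE_alive_iff[OF xS, of n]] AE_space[of "completion (law X x)"]
    by eventually_elim (auto simp: in_at_def space_law[OF xS])
  have "alive X n \<in> sets (completion (law X x))"
    by (rule completion.in_sets_AE[OF ae B]) (auto simp: alive_def space_law[OF xS])
  then have "measure (completion (law X x)) (alive X n) = measure (completion (law X x)) (in_at X n (space E))"
    using ae B by (intro measure_eq_AE) auto
  then show ?thesis
    unfolding pr_from_def measure_kern[OF x sets.top]
    using in_at_sets[OF live_in_SS[OF sets.top]] by (simp add: sets_law[OF xS])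
qed

lemma pr_from_in_at:
  assumes x: "x \<in> space E" and A: "A \<in> sets E"
  shows "pr_from X x (in_at X n A) = measure (kern n x) A"
  unfolding pr_from_def measure_kern[OF x A]
  using in_at_sets[OF live_in_SS[OF A]] sets_law[OF live_imp_state[OF x]] by simp

lemma semigrp_eq:
  assumes x: "x \<in> space E" and f: "f \<in> borel_measurable E"
  shows "semigrp X n f x = (\<integral>\<^sup>+y. ennreal (f y) \<partial>kern n x)"
proof -
  have xS: "x \<in> space SS" by (rule live_imp_state[OF x])
  have ES: "space E \<inter> space SS \<in> sets SS" using live_in_SS[OF sets.top] by auto
  have meas: "(\<lambda>y. ennreal (f y) * indicator (space E) y) \<in> borel_measurable SS"
    using f by (subst borel_measurable_restrict_space_iff_ennreal[symmetric, OF ES])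
      (simp add: measurable_cong_sets[OF sets_trace refl])
  have "semigrp X n f x = (\<integral>\<^sup>+\<omega>. ennreal (f (proc X (real n) \<omega>)) * indicator (alive X n) \<omega> \<partial>law X x)"
    unfolding semigrp_def by (rule nn_integral_completion)
  also have "\<dots> = (\<integral>\<^sup>+\<omega>. ennreal (f (proc X (real n) \<omega>)) * indicator (space E) (proc X (real n) \<omega>) \<partial>law X x)"
    using AE_alive_iff[OF xS, of n] by (intro nn_integral_cong_AE) (auto elim!: eventually_mono simp: indicator_def)
  also have "\<dots> = (\<integral>\<^sup>+y. ennreal (f y) * indicator (space E) y \<partial>distr (law X x) SS (proc X (real n)))"
    by (rule nn_integral_distr[OF proc_measurable_law[OF xS], symmetric]) (simp add: meas)
  also have "\<dots> = (\<integral>\<^sup>+y. ennreal (f y) \<partial>kern n x)"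
    unfolding kern_def using ES by (intro nn_integral_restrict_space[symmetric]) simp
  finally show ?thesis .
qed

text \<open>
  Started at the cemetery, the process has absorption time zero, so it stays there.  This makes
  the restricted kernels a semigroup.
\<close>

lemma measure_law_cemetery:
  assumes A: "A \<in> sets E"
  shows "measure (law X (cemetery X)) (in_at X n A) = 0"
proof -
  let ?d = "cemetery X"
  have d: "?d \<in> space SS" by (simp add: space_SS)
  interpret prob_space "law X ?d" by (rule prob_law[OF d])
  have "emeasure (law X ?d) (in_at X 0 {?d}) = 1"
    by (simp add: emeasure_in_at_0[OF d cemetery_in_SS])
  then have "prob (in_at X 0 {?d}) = 1" by (simp add: measure_def)
  moreover have "in_at X 0 {?d} \<in> events" using in_at_sets[OF cemetery_in_SS] by (simp add: sets_law[OF d])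
  ultimately have "AE \<omega> in law X ?d. \<omega> \<in> in_at X 0 {?d}" by (simp add: prob_eq_1)
  with AE_absorbed[OF d, of n] have "AE \<omega> in law X ?d. \<omega> \<notin> in_at X n A"
  proof eventually_elim
    case (elim \<omega>)
    then have "absorption_time X \<omega> \<le> ereal (real 0)" by (intro absorption_time_le) (auto simp: in_at_def)
    also have "\<dots> \<le> ereal (real n)" by simp
    finally show ?case using elim cemetery_notin sets.sets_into_space[OF A] by (auto simp: in_at_def)
  qed
  moreover have "in_at X n A \<in> events" using in_at_sets[OF live_in_SS[OF A]] by (simp add: sets_law[OF d])
  ultimately show ?thesis by (simp add: prob_eq_0)
qed

text \<open>
  The expectation of the Markov property, in which the conditional expectation disappears.
\<close>

lemma markov_integrated:
  assumes x: "x \<in> space SS" and B: "B \<in> sets SS"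
  shows "measure (law X x) (in_at X (m + n) B)
    = (\<integral>\<omega>. measure (law X (proc X (real m) \<omega>)) (in_at X n B) \<partial>law X x)"
proof -
  interpret prob_space "law X x" by (rule prob_law[OF x])
  let ?G = "{proc X u -` A \<inter> space (sample X) | u A. u \<in> time_set X \<and> u \<le> real m \<and> A \<in> sets SS}"
  have G: "?G \<subseteq> sets (sample X)"
    using markov by (auto simp: absorbed_markov_process_def intro!: measurable_sets)
  have G': "?G \<subseteq> Pow (space (sample X))" by auto
  have sub: "subalgebra (law X x) (natural_filtration X (real m))"
    using sets.sigma_sets_subset[OF G]
    by (simp add: subalgebra_def natural_filtration_def space_measure_of[OF G'] sets_measure_of[OF G']
        space_law[OF x] sets_law[OF x])
  interpret finite_measure_subalgebra "law X x" "natural_filtration X (real m)"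
    by unfold_locales (rule sub)
  have ev: "in_at X (m + n) B \<in> events" using in_at_sets[OF B] by (simp add: sets_law[OF x])
  let ?I = "\<lambda>\<omega>. indicator B (proc X (real m + real n) \<omega>) :: real"
  have I: "?I \<omega> = indicator (in_at X (m + n) B) \<omega>" if "\<omega> \<in> space (law X x)" for \<omega>
    using that by (simp add: in_at_def space_law[OF x] indicator_def)
  have "integrable (law X x) ?I \<longleftrightarrow> integrable (law X x) (indicator (in_at X (m + n) B) :: _ \<Rightarrow> real)"
    by (rule Bochner_Integration.integrable_cong[OF refl I])
  then have int: "integrable (law X x) ?I" using ev by (simp add: integrable_indicator_iff emeasure_eq_measure)
  have ae: "AE \<omega> in law X x. real_cond_exp (law X x) (natural_filtration X (real m)) ?I \<omega>
      = measure (law X (proc X (real m) \<omega>)) (in_at X n B)"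
    using markov x B real_in_time_set unfolding absorbed_markov_process_def in_at_def by blast
  have "measure (law X x) (in_at X (m + n) B) = (\<integral>\<omega>. ?I \<omega> \<partial>law X x)"
    using ev I by (subst Bochner_Integration.integral_cong[OF refl I]) (auto simp: Int_absorb2 sets.sets_into_space)
  also have "\<dots> = (\<integral>\<omega>. real_cond_exp (law X x) (natural_filtration X (real m)) ?I \<omega> \<partial>law X x)"
    by (rule real_cond_exp_int(2)[OF int, symmetric])
  also have "\<dots> = (\<integral>\<omega>. measure (law X (proc X (real m) \<omega>)) (in_at X n B) \<partial>law X x)"
    using ae measurable_compose[OF proc_measurable_law[OF x] measure_law_measurable[OF B]]
    by (intro integral_cong_AE) auto
  finally show ?thesis .
qed

text \<open>
  In the integrated Markov property the intermediate position contributes only if it lies in \<open>E\<close>.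
\<close>

lemma kern_add:
  assumes x: "x \<in> space E"
  shows "kern (m + n) x = kern m x \<bind> kern n"
proof (rule measure_eqI)
  have k: "kern n \<in> measurable (kern m x) (subprob_algebra E)"
    using kern_measurable by (simp add: measurable_cong_sets[OF sets_kern[OF x] refl])
  have ne: "space (kern m x) \<noteq> {}" using x by (auto simp: space_kern[OF x])
  show "sets (kern (m + n) x) = sets (kern m x \<bind> kern n)"
    using ne by (subst sets_bind[where N=E]) (auto simp: sets_kern[OF x] space_kern[OF x] intro!: sets_kern)
  fix A assume "A \<in> sets (kern (m + n) x)"
  then have A: "A \<in> sets E" by (simp add: sets_kern[OF x])
  have xS: "x \<in> space SS" by (rule live_imp_state[OF x])
  interpret prob_space "law X x" by (rule prob_law[OF xS])
  let ?q = "\<lambda>y. measure (law X y) (in_at X n A)"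
  have q: "?q \<in> borel_measurable SS" by (rule measure_law_measurable[OF live_in_SS[OF A]])
  have ES: "space E \<inter> space SS \<in> sets SS" using live_in_SS[OF sets.top] by auto
  have le1: "?q y \<le> 1" if "y \<in> space SS" for y
    by (rule prob_space.prob_le_1[OF prob_law[OF that]])
  have "emeasure (kern (m + n) x) A = ennreal (measure (law X x) (in_at X (m + n) A))"
    by (simp add: emeasure_kern[OF x A] emeasure_eq_measure)
  also have "\<dots> = ennreal (\<integral>\<omega>. ?q (proc X (real m) \<omega>) \<partial>law X x)"
    by (simp add: markov_integrated[OF xS live_in_SS[OF A]])
  also have "\<dots> = (\<integral>\<^sup>+\<omega>. ennreal (?q (proc X (real m) \<omega>)) \<partial>law X x)"
  proof (rule nn_integral_eq_integral[symmetric])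
    show "integrable (law X x) (\<lambda>\<omega>. ?q (proc X (real m) \<omega>))"
      using measurable_compose[OF proc_measurable_law[OF xS] q] measurable_space[OF proc_measurable_law[OF xS]]
      by (intro integrable_const_bound[where B=1] AE_I2) (auto intro!: le1)
  qed simp
  also have "\<dots> = (\<integral>\<^sup>+y. ennreal (?q y) \<partial>distr (law X x) SS (proc X (real m)))"
    using q by (intro nn_integral_distr[OF proc_measurable_law[OF xS], symmetric]) simp
  also have "\<dots> = (\<integral>\<^sup>+y. ennreal (?q y) * indicator (space E) y \<partial>distr (law X x) SS (proc X (real m)))"
    by (intro nn_integral_cong) (auto simp: space_SS measure_law_cemetery[OF A] indicator_def)
  also have "\<dots> = (\<integral>\<^sup>+y. ennreal (?q y) \<partial>kern m x)"
    unfolding kern_def using ES by (intro nn_integral_restrict_space[symmetric]) simp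
  also have "\<dots> = (\<integral>\<^sup>+y. emeasure (kern n y) A \<partial>kern m x)"
  proof (intro nn_integral_cong)
    fix y assume "y \<in> space (kern m x)"
    then have y: "y \<in> space E" by (simp add: space_kern[OF x])
    interpret y: prob_space "law X y" by (rule prob_law[OF live_imp_state[OF y]])
    show "ennreal (?q y) = emeasure (kern n y) A" by (simp add: emeasure_kern[OF y A] y.emeasure_eq_measure)
  qed
  also have "\<dots> = emeasure (kern m x \<bind> kern n) A" by (rule emeasure_bind[OF ne k A, symmetric])
  finally show "emeasure (kern (m + n) x) A = emeasure (kern m x \<bind> kern n) A" .
qed

lemma ennreal_pr_init_alive_in:
  assumes \<mu>: "prob_space \<mu>" "sets \<mu> = sets E" and A: "A \<in> sets E"
  shows "ennreal (pr_init X \<mu> (in_at X n A \<inter> alive X n)) = (\<integral>\<^sup>+x. emeasure (kern n x) A \<partial>\<mu>)"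
proof -
  interpret \<mu>: prob_space \<mu> by (rule \<mu>(1))
  have sp: "space \<mu> = space E" by (rule sets_eq_imp_space_eq[OF \<mu>(2)])
  have eq: "pr_init X \<mu> (in_at X n A \<inter> alive X n) = (\<integral>x. measure (kern n x) A \<partial>\<mu>)"
    unfolding pr_init_def using A by (intro Bochner_Integration.integral_cong refl pr_from_alive_in) (auto simp: sp)
  have fin: "emeasure (kern n x) A = ennreal (measure (kern n x) A)" if "x \<in> space E" for x
    using subprob_kern[OF that, of n] by (simp add: finite_measure.emeasure_eq_measure subprob_space_def)
  have "(\<lambda>x. emeasure (kern n x) A) \<in> borel_measurable E"
    by (rule measurable_emeasure_kernel[OF kern_measurable A])
  then have m: "(\<lambda>x. measure (kern n x) A) \<in> borel_measurable \<mu>"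
    unfolding measure_def by (simp add: measurable_cong_sets[OF \<mu>(2) refl])
  have "integrable \<mu> (\<lambda>x. measure (kern n x) A)"
    using subprob_space.subprob_measure_le_1[OF subprob_kern]
    by (intro \<mu>.integrable_const_bound[where B=1] m AE_I2) (auto simp: sp)
  then show ?thesis
    unfolding eq by (subst nn_integral_eq_integral[symmetric]) (auto simp: sp fin intro!: nn_integral_cong)
qed

lemma pr_init_alive_0:
  assumes "prob_space \<mu>" "sets \<mu> = sets E"
  shows "pr_init X \<mu> (alive X 0) = 1"
proof -
  have "pr_init X \<mu> (alive X 0) = (\<integral>x. 1 \<partial>\<mu>)"
    unfolding pr_init_def
    by (intro Bochner_Integration.integral_cong refl)
       (auto simp: sets_eq_imp_space_eq[OF assms(2)] pr_from_alive kern_0 measure_return)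
  then show ?thesis using prob_space.prob_space[OF assms(1)] by simp
qed

text \<open>
  Multiplying the conditional law by the survival probability \<open>\<theta>\<^sup>n\<close> turns quasi-stationarity into a
  linear eigenvalue equation.
\<close>

lemma quasi_stationary_eigenmeasure:
  assumes q: "quasi_stationary X \<mu>" and decay: "\<And>n. pr_init X \<mu> (alive X n) = \<theta> ^ n" and \<theta>: "0 < \<theta>"
    and A: "A \<in> sets E"
  shows "(\<integral>\<^sup>+x. emeasure (kern n x) A \<partial>\<mu>) = ennreal (\<theta> ^ n) * emeasure \<mu> A"
proof -
  have \<mu>: "prob_space \<mu>" "sets \<mu> = sets E" using q by (auto simp: quasi_stationary_def)
  interpret \<mu>: prob_space \<mu> by (rule \<mu>(1))
  have "pr_init X \<mu> (in_at X n A \<inter> alive X n) / \<theta> ^ n = measure \<mu> A"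
    using q A unfolding quasi_stationary_def decay by blast
  then have "pr_init X \<mu> (in_at X n A \<inter> alive X n) = \<theta> ^ n * measure \<mu> A"
    using \<theta> by (simp add: field_simps)
  then show ?thesis
    using \<theta> by (simp add: ennreal_pr_init_alive_in[OF \<mu> A, symmetric] ennreal_mult' \<mu>.emeasure_eq_measure)
qed

text \<open>
  The case to exclude is a vanishing infimum: the quotient is then infinite unless the supremum
  vanishes too, and in that case there is nothing to show.
\<close>

lemma harnack_from_ratio:
  assumes "(SUP n. (SUP y\<in>K. ennreal (pr_from X y (alive X n))) /
             (INF y\<in>K. ennreal (pr_from X y (alive X n)))) \<le> ennreal c"
    and c: "0 \<le> c" and x: "x \<in> K" and y: "y \<in> K"
  shows "pr_from X x (alive X n) \<le> c * pr_from X y (alive X n)"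
proof -
  let ?p = "\<lambda>y. ennreal (pr_from X y (alive X n))"
  let ?s = "SUP y\<in>K. ?p y" and ?i = "INF y\<in>K. ?p y"
  have ratio: "?s / ?i \<le> ennreal c"
    using assms(1) SUP_upper[of n UNIV "\<lambda>n. (SUP y\<in>K. ennreal (pr_from X y (alive X n))) /
             (INF y\<in>K. ennreal (pr_from X y (alive X n)))"] by (meson UNIV_I order_trans)
  have "?p x \<le> ?s" by (rule SUP_upper[OF x])
  also have "?s \<le> ennreal c * ?i"
  proof (cases "?i = 0")
    case True
    have "?s = 0"
    proof (rule ccontr)
      assume "?s \<noteq> 0"
      with True have "?s / ?i = top" by (simp add: ennreal_divide_eq_top_iff)
      with ratio show False by (simp add: top_unique)
    qed
    then show ?thesis by simp
  next
    case False
    have fin: "?i < top" using INF_lower[OF y, of ?p] by (rule le_less_trans) simp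
    have "?s = ?s / ?i * ?i" using False fin by (simp add: ennreal_divide_times ennreal_mult_divide_eq)
    also have "\<dots> \<le> ennreal c * ?i" by (rule mult_right_mono[OF ratio]) simp
    finally show ?thesis .
  qed
  also have "\<dots> \<le> ennreal c * ?p y" by (intro mult_left_mono INF_lower[OF y]) simp
  also have "\<dots> = ennreal (c * pr_from X y (alive X n))"
    using c by (simp add: ennreal_mult' pr_from_def)
  finally show ?thesis using c by (simp add: pr_from_def ennreal_le_iff)
qed

end

section \<open>Conclusion\<close>

lemma geometric_convergenceI:
  assumes h: "\<And>n. h n \<in> borel_measurable E" and g: "g \<in> borel_measurable E"
    and \<psi>: "\<And>x. x \<in> space E \<Longrightarrow> 1 \<le> \<psi> x"
    and bd_h: "\<And>n x. x \<in> space E \<Longrightarrow> \<bar>h n x\<bar> \<le> B * \<psi> x"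
    and bd_g: "\<And>x. x \<in> space E \<Longrightarrow> \<bar>g x\<bar> \<le> C * \<psi> x"
    and A: "0 < A" "0 < \<alpha>" "\<alpha> < 1"
    and conv: "\<And>n x. x \<in> space E \<Longrightarrow> \<bar>h n x - g x\<bar> \<le> A * \<alpha> ^ n * \<psi> x"
  shows "geometric_convergence E \<psi> h g"
proof -
  have norm: "Linf_norm E \<psi> f \<le> ennreal c" if "\<And>x. x \<in> space E \<Longrightarrow> \<bar>f x\<bar> \<le> c * \<psi> x" for f c
    unfolding Linf_norm_def
  proof (rule SUP_least)
    fix x assume "x \<in> space E"
    with that[of x] \<psi>[of x] show "ennreal (\<bar>f x\<bar> / \<psi> x) \<le> ennreal c"
      by (intro ennreal_leI) (simp add: pos_divide_le_eq)
  qed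
  have "Linf_norm E \<psi> (h n) < \<infinity>" "Linf_norm E \<psi> g < \<infinity>" for n
    using norm[OF bd_h[of _ n]] norm[OF bd_g] by (auto intro: le_less_trans)
  moreover have "Linf_norm E \<psi> (\<lambda>x. h n x - g x) \<le> ennreal (A * \<alpha> ^ n)" for n
    by (rule norm[OF conv])
  ultimately show ?thesis
    unfolding geometric_convergence_def Linf_def using h g A by blast
qed

theorem theorem2p2:
  fixes M :: "('a, 'w) absorbed_process"
    and n1 :: nat and \<theta>1 \<theta>2 c1 c2 c3 \<theta>0 :: real
    and \<phi>1 \<phi>2 :: "'a \<Rightarrow> real"
    and \<nu> \<nu>QSD :: "'a measure" and K :: "'a set"
  assumes "absorbed_markov_process M"
    and "assumption_E M n1 \<theta>1 \<theta>2 c1 c2 c3 \<phi>1 \<phi>2 \<nu> K"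
    and "quasi_stationary M \<nu>QSD"
    and "(\<integral>\<^sup>+x. ennreal (\<phi>1 x) \<partial>\<nu>QSD) < \<infinity>"
    and "(\<integral>\<^sup>+x. ennreal (\<phi>2 x) \<partial>\<nu>QSD) > 0"
    and "0 < \<theta>0" and "\<theta>0 \<le> 1"
    and "\<And>n. n \<ge> 1 \<Longrightarrow> pr_init M \<nu>QSD (alive M n) = \<theta>0 ^ n"
  shows "\<exists>\<eta> :: 'a \<Rightarrow> real.
    (\<forall>x\<in>space (live M). \<eta> x \<ge> 0) \<and>
    (\<forall>x\<in>space (live M).
       (\<lambda>n. pr_from M x (alive M n) / pr_init M \<nu>QSD (alive M n)) \<longlonglongrightarrow> \<eta> x) \<and>
    (\<forall>x\<in>space (live M).
       (\<lambda>n. inverse (\<theta>0 ^ n) * pr_from M x (alive M n)) \<longlonglongrightarrow> \<eta> x) \<and>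
    geometric_convergence (live M) \<phi>1
       (\<lambda>n x. pr_from M x (alive M n) / pr_init M \<nu>QSD (alive M n)) \<eta> \<and>
    geometric_convergence (live M) \<phi>1
       (\<lambda>n x. inverse (\<theta>0 ^ n) * pr_from M x (alive M n)) \<eta> \<and>
    (INF y\<in>K. \<eta> y) > 0 \<and>
    (\<integral>\<^sup>+x. ennreal (\<eta> x) \<partial>\<nu>QSD) = 1 \<and>
    \<eta> \<in> Linf (live M) (\<lambda>x. \<phi>1 x powr (ln (1 / \<theta>0) / ln (1 / \<theta>1))) \<and>
    (\<forall>x\<in>space (live M). semigrp M 1 \<eta> x = ennreal (\<theta>0 * \<eta> x)) \<and>
    \<theta>0 \<ge> \<theta>2 \<and> \<theta>2 > \<theta>1"
proof -
  interpret absorbed_chain M by unfold_locales (rule assms(1))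
  note E = assms(2)[unfolded assumption_E_def]
  note \<theta>0 = assms(6,7)
  from E have pos: "\<theta>1 > 0" "\<theta>2 > 0" "c1 > 0" "c2 > 0" "c3 > 0"
    by - (elim conjE, assumption)+
  from E have \<phi>1_m: "\<phi>1 \<in> borel_measurable (live M)" and \<phi>2_m: "\<phi>2 \<in> borel_measurable (live M)"
    and K: "K \<in> sets (live M)" and \<nu>: "prob_space \<nu>" and sets_\<nu>: "sets \<nu> = sets (restrict_space (live M) K)"
    and \<theta>12: "\<theta>1 < \<theta>2" and bdd: "bdd_above (\<phi>1 ` K)" by - (elim conjE, assumption)+
  from E have \<phi>1_ge_1: "\<forall>x\<in>space (live M). \<phi>1 x \<ge> 1" and \<phi>2_le_1: "\<forall>x\<in>space (live M). \<phi>2 x \<le> 1"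
    and \<phi>2_nonneg: "\<forall>x\<in>space (live M). \<phi>2 x \<ge> 0" by - (elim conjE, assumption)+
  from E have E1: "\<forall>x\<in>K. \<forall>A\<in>sets (state_space M). pr_from M x (in_at M n1 A) \<ge> c1 * measure \<nu> (A \<inter> K)"
    by - (elim conjE, assumption)
  from E have E2: "\<forall>x\<in>space (live M). semigrp M 1 \<phi>1 x \<le> ennreal (\<theta>1 * \<phi>1 x + c2 * indicator K x)"
    and E2': "\<forall>x\<in>space (live M). semigrp M 1 \<phi>2 x \<ge> ennreal (\<theta>2 * \<phi>2 x)" by - (elim conjE, assumption)+
  from E have E3: "(SUP n. (SUP y\<in>K. ennreal (pr_from M y (alive M n))) /
             (INF y\<in>K. ennreal (pr_from M y (alive M n)))) \<le> ennreal c3" by - (elim conjE, assumption)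
  from E have E4: "\<forall>x\<in>K. \<exists>n4. \<forall>n\<ge>n4. pr_from M x (in_at M n K) > 0" by - (elim conjE, assumption)
  have K_live: "x \<in> space (live M)" if "x \<in> K" for x using that sets.sets_into_space[OF K] by blast

  have qsd: "prob_space \<nu>QSD" "sets \<nu>QSD = sets (live M)"
    using assms(3) by (auto simp: quasi_stationary_def)
  have space_qsd: "space \<nu>QSD = space (live M)" by (rule sets_eq_imp_space_eq[OF qsd(2)])
  \<comment> \<open>The decay rate is given for \<open>n \<ge> 1\<close>; for \<open>n = 0\<close> it holds as \<open>X\<^sub>0\<close> lies in \<open>E\<close>.\<close>
  have decay: "pr_init M \<nu>QSD (alive M n) = \<theta>0 ^ n" for n
    using assms(8)[of n] pr_init_alive_0[OF qsd] by (cases n) auto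
  note eigen = quasi_stationary_eigenmeasure[OF assms(3) decay \<theta>0(1)]

  have \<theta>20: "\<theta>2 \<le> \<theta>0"
  proof -
    let ?I = "\<integral>\<^sup>+x. ennreal (\<phi>2 x) \<partial>\<nu>QSD"
    have [measurable]: "(\<lambda>x. ennreal (\<phi>2 x)) \<in> borel_measurable \<nu>QSD"
      using \<phi>2_m by (simp add: measurable_cong_sets[OF qsd(2) refl])
    have "?I \<le> (\<integral>\<^sup>+x. 1 \<partial>\<nu>QSD)"
      using \<phi>2_le_1 by (intro nn_integral_mono) (auto simp: space_qsd ennreal_le_1)
    then have le1: "?I \<le> 1" using prob_space.emeasure_space_1[OF qsd(1)] by simp
    have "ennreal \<theta>2 * ?I = (\<integral>\<^sup>+x. ennreal \<theta>2 * ennreal (\<phi>2 x) \<partial>\<nu>QSD)"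
      by (rule nn_integral_cmult[symmetric]) measurable
    also have "\<dots> \<le> (\<integral>\<^sup>+x. (\<integral>\<^sup>+y. ennreal (\<phi>2 y) \<partial>kern 1 x) \<partial>\<nu>QSD)"
      using E2' pos by (intro nn_integral_mono) (auto simp: space_qsd semigrp_eq[OF _ \<phi>2_m] ennreal_mult')
    also have "\<dots> = ennreal (\<theta>0 ^ 1) * ?I"
      using \<phi>2_m by (intro nn_integral_eigenmeasure[OF prob_space.not_empty[OF qsd(1)] qsd(2) kern_measurable eigen]) auto
    finally have le: "ennreal \<theta>2 * ?I \<le> ennreal \<theta>0 * ?I" by simp
    obtain i where i: "?I = ennreal i" "0 \<le> i" using le1 by (cases ?I) (auto simp: top_unique)
    have "0 < i" using assms(5) i by (simp add: ennreal_less_zero_iff)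
    with le i pos \<theta>0 show ?thesis by (simp add: ennreal_mult'[symmetric] ennreal_le_iff)
  qed

  have E2_kern: "(\<integral>\<^sup>+y. ennreal (\<phi>1 y) \<partial>kern 1 x) \<le> ennreal (\<theta>1 * \<phi>1 x + c2 * indicator K x)"
    if x: "x \<in> space (live M)" for x
    using E2[rule_format, OF x] unfolding semigrp_eq[OF x \<phi>1_m] .
  interpret weighted_semigroup "live M" kern \<phi>1 \<theta>0 "\<theta>1 + c2"
  proof
    show "(\<integral>\<^sup>+y. ennreal (\<phi>1 y) \<partial>kern 1 x) \<le> ennreal ((\<theta>1 + c2) * \<phi>1 x)" if x: "x \<in> space (live M)" for x
    proof -
      have "(\<integral>\<^sup>+y. ennreal (\<phi>1 y) \<partial>kern 1 x) \<le> ennreal (\<theta>1 * \<phi>1 x + c2 * indicator K x)"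
        by (rule E2_kern[OF x])
      also have "\<dots> \<le> ennreal ((\<theta>1 + c2) * \<phi>1 x)"
      proof (rule ennreal_leI)
        have "c2 * indicator K x \<le> c2 * \<phi>1 x"
          using \<phi>1_ge_1 x pos by (intro mult_left_mono) (auto simp: indicator_def intro: order_trans[of 0 1])
        then show "\<theta>1 * \<phi>1 x + c2 * indicator K x \<le> (\<theta>1 + c2) * \<phi>1 x" by (simp add: algebra_simps)
      qed
      finally show ?thesis .
    qed
  qed (use pos \<theta>0 \<phi>1_ge_1 \<phi>1_m in \<open>auto intro: kern_measurable kern_0 kern_add\<close>)

  have h_eq: "S n (\<lambda>_. 1) x = pr_from M x (alive M n) / \<theta>0 ^ n" if "x \<in> space (live M)" for n x
    by (simp add: S_def pr_from_alive[OF that] space_kern[OF that])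
  have K_eq: "S n (indicator K) x = pr_from M x (in_at M n K) / \<theta>0 ^ n" if "x \<in> space (live M)" for n x
    using K_live by (simp add: S_def pr_from_in_at[OF that K] space_kern[OF that] Int_absorb2 subset_iff)

  \<comment> \<open>\<open>\<nu>\<close> is a measure on \<open>K\<close>; its image under the inclusion is the measure on \<open>E\<close> required above.\<close>
  define \<nu>' where "\<nu>' = distr \<nu> (live M) (\<lambda>x. x)"
  have \<nu>_space: "space \<nu> = K"
    using sets_eq_imp_space_eq[OF sets_\<nu>] sets.sets_into_space[OF K] by (auto simp: space_restrict_space)
  have id: "(\<lambda>x. x) \<in> measurable \<nu> (live M)"
    by (subst measurable_cong_sets[OF sets_\<nu> refl]) (rule measurable_restrict_space1, simp)
  interpret \<nu>: prob_space \<nu> by (rule \<nu>)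
  have em_\<nu>': "emeasure \<nu>' A = ennreal (measure \<nu> (A \<inter> K))" if "A \<in> sets (live M)" for A
    using that by (simp add: \<nu>'_def emeasure_distr[OF id] \<nu>_space \<nu>.emeasure_eq_measure)
  obtain v where v: "\<And>x. x \<in> K \<Longrightarrow> \<phi>1 x \<le> v" using bdd by (auto simp: bdd_above_def)

  interpret quasi_stationary_semigroup "live M" kern \<phi>1 \<theta>0 "\<theta>1 + c2" \<nu>QSD \<nu>' K "\<theta>1 / \<theta>0" "c2 / \<theta>0" c1 c3 v n1
  proof (intro quasi_stationary_semigroup.intro quasi_stationary_semigroup_axioms.intro weighted_semigroup_axioms)
    show "prob_space \<nu>QSD" "sets \<nu>QSD = sets (live M)" by (rule qsd)+
    show "(\<integral>\<^sup>+x. emeasure (kern n x) A \<partial>\<nu>QSD) = ennreal (\<theta>0 ^ n) * emeasure \<nu>QSD A" if "A \<in> sets (live M)" for A n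
      by (rule eigen[OF that])
    show "(\<integral>\<^sup>+x. ennreal (\<phi>1 x) \<partial>\<nu>QSD) < \<infinity>" by (rule assms(4))
    show "\<theta>0 \<le> 1" by (rule \<theta>0(2))
    show "K \<in> sets (live M)" by (rule K)
    show "0 \<le> \<theta>1 / \<theta>0" "\<theta>1 / \<theta>0 < 1" "0 \<le> c2 / \<theta>0" "0 < c3" "0 < c1" using pos \<theta>0 \<theta>12 \<theta>20 by auto
    show "S 1 \<phi>1 x \<le> \<theta>1 / \<theta>0 * \<phi>1 x + c2 / \<theta>0 * indicator K x" if x: "x \<in> space (live M)" for x
    proof -
      have nn: "0 \<le> \<theta>1 * \<phi>1 x + c2 * indicator K x" using pos \<phi>1_ge_1 x
        by (intro add_nonneg_nonneg mult_nonneg_nonneg) (auto intro: order_trans[of 0 1])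
      have "ennreal (S 1 \<phi>1 x) = ennreal (1 / \<theta>0 ^ 1) * (\<integral>\<^sup>+y. ennreal (\<phi>1 y) \<partial>kern 1 x)"
        using \<phi>1_ge_1 by (intro ennreal_S x wbdd_V) (auto intro: order_trans[of 0 1])
      also have "\<dots> \<le> ennreal (1 / \<theta>0 ^ 1) * ennreal (\<theta>1 * \<phi>1 x + c2 * indicator K x)"
        by (intro mult_left_mono E2_kern[OF x]) simp
      also have "\<dots> = ennreal (\<theta>1 / \<theta>0 * \<phi>1 x + c2 / \<theta>0 * indicator K x)"
        using \<theta>0 nn by (simp add: ennreal_mult'[symmetric] add_divide_distrib)
      finally show ?thesis
        using nn \<theta>0 by (subst (asm) ennreal_le_iff) (auto simp: add_divide_distrib[symmetric])
    qed
    show "S n (\<lambda>_. 1) x \<le> c3 * S n (\<lambda>_. 1) y" if "x \<in> K" "y \<in> K" for x y n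
      using harnack_from_ratio[OF E3 _ that, of n] pos \<theta>0 that
      by (simp add: h_eq K_live divide_right_mono)
    show "\<phi>1 x \<le> v" if "x \<in> K" for x by (rule v[OF that])
    show "prob_space \<nu>'" unfolding \<nu>'_def by (rule \<nu>.prob_space_distr[OF id])
    show "sets \<nu>' = sets (live M)" by (simp add: \<nu>'_def)
    show "AE x in \<nu>'. x \<in> K"
      unfolding \<nu>'_def using K by (subst AE_distr_iff[OF id]) (auto simp: \<nu>_space[symmetric] Int_def[symmetric])
    show "ennreal c1 * emeasure \<nu>' A \<le> emeasure (kern n1 x) A" if x: "x \<in> K" and A: "A \<in> sets (live M)" for x A
    proof -
      have xE: "x \<in> space (live M)" by (rule K_live[OF x])
      have "c1 * measure \<nu> (A \<inter> K) \<le> measure (kern n1 x) A"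
        using E1 x live_in_SS[OF A] pr_from_in_at[OF xE A, of n1] by fastforce
      then show ?thesis
        using subprob_kern[OF xE, of n1] pos
        by (simp add: em_\<nu>'[OF A] ennreal_mult'[symmetric] finite_measure.emeasure_eq_measure subprob_space_def ennreal_leI)
    qed
    show "\<exists>n4. \<forall>n\<ge>n4. 0 < S n (indicator K) x" if x: "x \<in> K" for x
      using E4[rule_format, OF x] \<theta>0(1) by (simp add: K_eq[OF K_live[OF x]] zero_less_divide_iff)
  qed

  obtain \<eta> C \<delta> where \<eta>: "wbdd \<eta>" "\<forall>x\<in>space (live M). 0 \<le> \<eta> x" "\<forall>x\<in>space (live M). S 1 \<eta> x = \<eta> x"
     "\<forall>x\<in>space (live M). \<eta> x \<le> C * \<phi>1 x" "0 < \<delta>" "\<forall>x\<in>K. \<delta> \<le> \<eta> x" "(\<integral>x. \<eta> x \<partial>\<nu>QSD) = 1"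
    using harmonic_function_exists by blast
  interpret ground_state "live M" kern \<phi>1 \<theta>0 "\<theta>1 + c2" \<nu>QSD \<nu>' K "\<theta>1 / \<theta>0" "c2 / \<theta>0" c1 c3 v n1 \<eta> C \<delta>
    by unfold_locales (use \<eta> in auto)
  obtain A \<alpha> where A: "0 < A" "0 < \<alpha>" "\<alpha> < 1"
    and conv: "\<forall>n. \<forall>x\<in>space (live M). \<bar>h n x - \<eta> x\<bar> \<le> A * \<alpha> ^ n * \<phi>1 x"
    by (rule h_converges_geometrically)

  have lim: "(\<lambda>n. h n x) \<longlonglongrightarrow> \<eta> x" if x: "x \<in> space (live M)" for x
  proof -
    have "(\<lambda>n. A * \<alpha> ^ n * \<phi>1 x) \<longlonglongrightarrow> A * 0 * \<phi>1 x"
      using A by (intro tendsto_intros LIMSEQ_realpow_zero) auto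
    then have "(\<lambda>n. h n x - \<eta> x) \<longlonglongrightarrow> 0"
      using conv x by (intro Lim_null_comparison[of "\<lambda>n. h n x - \<eta> x"]) auto
    then show ?thesis by (simp add: LIM_zero_iff)
  qed
  have quot: "pr_from M x (alive M n) / pr_init M \<nu>QSD (alive M n) = h n x"
    and inv: "inverse (\<theta>0 ^ n) * pr_from M x (alive M n) = h n x" if "x \<in> space (live M)" for n x
    using that by (simp_all add: decay h_eq field_simps)
  have geo: "geometric_convergence (live M) \<phi>1 g \<eta>" if g: "\<And>n x. x \<in> space (live M) \<Longrightarrow> g n x = h n x" for g
  proof (rule geometric_convergenceI[OF _ _ _ _ _ A])
    show "g n \<in> borel_measurable (live M)" for n
      using S_measurable[OF wbdd_const, of n 1] by (simp add: g cong: measurable_cong)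
    show "\<bar>g n x\<bar> \<le> max 1 h_bound * \<phi>1 x" if "x \<in> space (live M)" for n x
      using h_le_V[OF that, of n] h_nonneg[OF that, of n] by (simp add: g[OF that])
    show "\<bar>\<eta> x\<bar> \<le> C * \<phi>1 x" if "x \<in> space (live M)" for x
      using \<eta>(2,4) that by simp
    show "\<bar>g n x - \<eta> x\<bar> \<le> A * \<alpha> ^ n * \<phi>1 x" if "x \<in> space (live M)" for n x
      using conv that by (simp add: g[OF that])
  qed (use \<phi>1_ge_1 wbdd_measurable[OF \<eta>(1)] in auto)

  have K_ne: "K \<noteq> {}" using \<nu>.not_empty unfolding \<nu>_space .
  have inf: "0 < (INF y\<in>K. \<eta> y)"
    using \<eta>(5,6) by (intro less_le_trans[OF \<eta>(5) cINF_greatest[OF K_ne]]) auto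
  have mass: "(\<integral>\<^sup>+x. ennreal (\<eta> x) \<partial>\<nu>QSD) = 1"
    using \<eta>(2,7) by (subst nn_integral_eq_integral[OF integrable_\<mu>[OF \<eta>(1)]]) (auto simp: space_qsd)
  have harmonic: "semigrp M 1 \<eta> x = ennreal (\<theta>0 * \<eta> x)" if x: "x \<in> space (live M)" for x
  proof -
    have "(\<integral>y. \<eta> y \<partial>kern 1 x) = \<theta>0 * \<eta> x"
      using \<eta>(3) x \<theta>0 by (simp add: S_def field_simps)
    then show ?thesis
      unfolding semigrp_eq[OF x wbdd_measurable[OF \<eta>(1)]]
      using \<eta>(2) by (subst nn_integral_eq_integral[OF integrable_\<kappa>[OF x \<eta>(1)]]) (auto simp: space_kern[OF x])
  qed
  have Linf: "\<eta> \<in> Linf (live M) (\<lambda>x. \<phi>1 x powr (ln (1 / \<theta>0) / ln (1 / \<theta>1)))"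
  proof -
    let ?p = "ln (1 / \<theta>0) / ln (1 / \<theta>1)"
    have \<theta>1: "0 < \<theta>1" "\<theta>1 < 1" "\<theta>1 \<le> \<theta>0" using pos \<theta>0 \<theta>12 \<theta>20 by auto
    have ln1: "ln \<theta>1 < 0" using \<theta>1 by simp
    have ln: "ln (1 / \<theta>0) = - ln \<theta>0" "ln (1 / \<theta>1) = - ln \<theta>1" using \<theta>0 \<theta>1 by (simp_all add: ln_div)
    have "ln \<theta>1 \<le> ln \<theta>0" using \<theta>0 \<theta>1 by simp
    then have p: "0 \<le> ?p" "?p \<le> 1" using ln1 \<theta>0 by (auto simp: ln divide_le_eq zero_le_divide_iff)
    \<comment> \<open>This identity determines the exponent: \<open>\<theta>1 = \<theta>0 (\<theta>1 / \<theta>0)\<close> is the rate \<open>\<theta> a\<close> of the drift.\<close>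
    have "\<theta>1 powr ?p = \<theta>0" using \<theta>1 \<theta>0 ln1 by (simp add: powr_def ln)
    then have "h n x \<le> max 1 h_bound * \<phi>1 x powr ?p" if "x \<in> space (live M)" for n x
      using \<theta>1 \<theta>0 by (intro h_le_V_powr p that) auto
    then have le: "\<eta> x \<le> max 1 h_bound * \<phi>1 x powr ?p" if "x \<in> space (live M)" for x
      using lim[OF that] that by (intro LIMSEQ_le_const2[OF lim[OF that]]) auto
    have "Linf_norm (live M) (\<lambda>x. \<phi>1 x powr ?p) \<eta> \<le> ennreal (max 1 h_bound)"
      unfolding Linf_norm_def
    proof (rule SUP_least)
      fix x assume x: "x \<in> space (live M)"
      have "0 < \<phi>1 x powr ?p" using \<phi>1_ge_1 x by (intro powr_gt_zero[THEN iffD2]) force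
      then show "ennreal (\<bar>\<eta> x\<bar> / \<phi>1 x powr ?p) \<le> ennreal (max 1 h_bound)"
        using le[OF x] \<eta>(2) x by (intro ennreal_leI) (simp add: pos_divide_le_eq)
    qed
    then show ?thesis
      using wbdd_measurable[OF \<eta>(1)] by (auto simp: Linf_def intro: le_less_trans)
  qed
  show ?thesis
  proof (intro exI[of _ \<eta>] conjI ballI)
    fix x assume x: "x \<in> space (live M)"
    show "0 \<le> \<eta> x" using \<eta>(2) x by blast
    show "(\<lambda>n. pr_from M x (alive M n) / pr_init M \<nu>QSD (alive M n)) \<longlonglongrightarrow> \<eta> x"
      using lim[OF x] by (simp only: quot[OF x])
    show "(\<lambda>n. inverse (\<theta>0 ^ n) * pr_from M x (alive M n)) \<longlonglongrightarrow> \<eta> x"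
      using lim[OF x] by (simp only: inv[OF x])
    show "semigrp M 1 \<eta> x = ennreal (\<theta>0 * \<eta> x)" by (rule harmonic[OF x])
  qed (use geo[OF quot] geo[OF inv] inf mass Linf \<theta>20 \<theta>12 in auto)
qed

end
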